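(* Let $\mathcal{G}=(\Gamma_{T_0},\mathcal{N},\mathcal{P})$ be a substitution-set grammar, let $\Gamma_T\in\mathcal{N}$, let $x_1,x_2\in\mathcal{V}ar(T)$, and assume that the production rules of $\mathcal{P}$ reachable from $\Gamma_T$ satisfy the shape assumption described in the context (so that $\mathcal{R}an(\mathcal{G},T,x_1,x_2)$ is constructed). Then $$L(\mathcal{R}an(\mathcal{G},T,x_1,x_2))\supseteq\{\langle \xi\theta(x_1),\xi\theta(x_2)\rangle\mid \theta\in\mathcal{S}ubst(\mathcal{G},\Gamma_T),\ \xi\in\mathit{Subst}(\mathcal{C}),\ \mathcal{V}ar(\theta(x_1),\theta(x_2))=\mathcal{D}om(\xi)\},$$ where $L(\mathcal{R}an(\mathcal{G},T,x_1,x_2))$ is the language generated from its initial non-terminal $\Gamma_T^{(x_1,x_2)}$.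
   Context: Fix a countably infinite set $\mathcal{V}$ of variables and a finite set $\mathcal{C}$ of constructor symbols with arities; $\mathcal{T}(\mathcal{C},\mathcal{V})$ denotes terms, $\mathcal{T}(\mathcal{C})$ ground terms, $\mathit{Subst}(\mathcal{C})$ the substitutions whose range consists of ground terms in $\mathcal{T}(\mathcal{C})$. $\mathcal{D}om$, $\mathcal{V}ar$ have their usual meaning; $\mathcal{VR}an(\sigma)=\bigcup_{x\in\mathcal{D}om(\sigma)}\mathcal{V}ar(\sigma(x))$. Composition: $(\theta\sigma)(x)=\theta(\sigma(x))$. A goal clause is a term (a conjunction of pairs of terms); $\top$ denotes the trivial goal clause without variables. $A$ is a fresh constant. Coding of pairs: over the signature $(\mathcal{C}\cup\{\bot\})^2$ ($\bot$ a new constant), the symbol $\langle f,g\rangle$ has arity $\max(\mathrm{arity}(f),\mathrm{arity}(g))$. For ground terms: $\langle f(s_1..s_m),g(t_1..t_n)\rangle=\langle f,g\rangle(\langle s_1,t_1\rangle,\dots,\langle s_m,t_m\rangle,\langle\bot,t_{m+1}\rangle,\dots,\langle\bot,t_n\rangle)$ if $m\le n$, and $=\langle f,g\rangle(\langle s_1,t_1\rangle,\dots,\langle s_n,t_n\rangle,\langle s_{n+1},\bot\rangle,\dots,\langle s_m,\bot\rangle)$ if $m>n$; $\langle f(s_1..s_m),\bot\rangle=\langle f,\bot\rangle(\langle s_1,\bot\rangle,\dots,\langle s_m,\bot\rangle)$; $\langle\bot,g(t_1..t_n)\rangle=\langle\bot,g\rangle(\langle\bot,t_1\rangle,\dots,\langle\bot,t_n\rangle)$.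 Substitution expressions: $\Sigma$ consists of finitely many idempotent substitutions (as constants), a constant $\varnothing$, associative binary symbols $\bullet$ and $\&$, and a binary symbol $\textsc{rec}$ whose second argument is always an idempotent renaming $\delta$. Parallel composition of idempotent substitutions: $\theta_1\Uparrow\theta_2$ is an idempotent most general unifier $\sigma$ of $\{x\approx\theta_1(x)\}\cup\{x\approx\theta_2(x)\}$ with $\mathcal{D}om(\theta_1)\cup\mathcal{D}om(\theta_2)\subseteq\mathcal{D}om(\sigma)$ if unifiable, and $\mathit{fail}$ otherwise. For substitutions $\sigma,\delta$, $\sigma^{\delta}=(\xi\sigma)|_{\mathcal{D}om(\sigma)}$ for a renaming $\xi$ with $\mathcal{D}om(\xi)=\mathcal{VR}an(\sigma)$ and $\mathcal{VR}an(\xi)$ disjoint from $\mathcal{D}om(\delta)\cup\mathcal{VR}an(\delta)\cup\mathcal{D}om(\sigma)$ and from all variables in substitutions of $\Sigma$. Semantics $[\![\cdot]\!]$ of ground terms over $\Sigma$: $[\![\theta]\!]=\theta$; $[\![e_1\bullet e_2]\!]=[\![e_1]\!]\cdot[\![e_2]\!]$; $[\![e_1\& e_2]\!]=(\theta_1\Uparrow\theta_2)|_{\mathcal{D}om(\theta_1)\cup\mathcal{D}om(\theta_2)}$ with $\theta_1=[\![e_1]\!]$, $\theta_2=[\![e_2]\!]^{\theta_1}$; $[\![\textsc{rec}(e,\delta)]\!]=([\![e]\!]^{\delta}\cdot\delta)|_{\mathcal{D}om(\delta)}$ provided $\mathcal{VR}an(\delta)\subseteq\mathcal{D}om([\![e]\!])$;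 in all other cases (including any subexpression yielding $\mathit{fail}$, and $\varnothing$) the result is $\mathit{fail}$. A substitution-set grammar (SSG) $\mathcal{G}=(\Gamma_{T_0},\mathcal{N},\mathcal{P})$ is a regular tree grammar whose non-terminals are constants $\Gamma_{T'}$ indexed by goal clauses $T'$, $\Gamma_{T_0}\in\mathcal{N}$, and whose rules have the form $\Gamma_{T'}\to\beta$ with $\beta$ a term over $\Sigma\cup\mathcal{N}$, non-terminals occurring only as first arguments of $\textsc{rec}$; in $\textsc{rec}(\Gamma_{t},\delta)$, $\delta$ is an idempotent renaming with $\mathcal{VR}an(\delta)\subseteq\mathcal{V}ar(t)$ and $\mathcal{D}om(\delta)\cap(\mathcal{V}ar(t)\setminus\mathcal{VR}an(\delta))=\emptyset$. $L(\mathcal{G},\Gamma)$ is the set of ground terms over $\Sigma$ derivable from $\Gamma$, and $\mathcal{S}ubst(\mathcal{G},\Gamma)=\{[\![e]\!]\mid e\in L(\mathcal{G},\Gamma),[\![e]\!]\neq\mathit{fail}\}$. Shape assumption: every rule reachable from $\Gamma_T$ is of the form $\Gamma_{T'}\to\theta$ or $\Gamma_{T'}\to\textsc{rec}(\Gamma_{T''},\delta)\bullet\theta$ (a rule $\Gamma_{T'}\to\textsc{rec}(\Gamma_{T''},\delta)$ counts as having $\theta=\mathit{id}$), where $\theta$ is idempotent with $\mathcal{D}om(\theta)=\mathcal{V}ar(T')$ and $\mathcal{VR}an(\delta)=\mathcal{V}ar(T'')$; and for each rule of the second kind, for all variables $x,y\in\mathcal{V}ar(T')$ and every $p\in\mathcal{P}os(\delta\theta(x))\cap\mathcal{P}os(\delta\theta(y))$: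 if $(\delta\theta(x))|_p\in\mathcal{V}ar(T'')$ then $(\delta\theta(y))|_p\in\mathcal{V}ar(T'')\cup\mathcal{T}(\mathcal{C},\mathcal{V}\setminus\mathcal{V}ar(T''))$, and symmetrically with $x,y$ swapped. Construction. $\mathrm{Pat}(\mathcal{P})=\{\{x\mapsto A\mid x\in\mathcal{V}ar(t)\}(t)\mid \theta$ appears in $\mathcal{P}$, $s\in\mathcal{R}an(\theta)$, $t$ a subterm of $s\}$; $\mathrm{Vars}(\mathcal{N})=\bigcup_{\Gamma_{T'}\in\mathcal{N}}\mathcal{V}ar(T')$. For a goal clause $T'$, the set $\langle s,t\rangle_{T'}$ is defined by: $\langle x,y\rangle_{T'}=\{\Gamma_{T'}^{(x,y)}\}$ for $x,y\in\mathcal{V}$; $\langle x,t\rangle_{T'}=\{\Gamma_{T'}^{(x,t)}\}$ and $\langle t,y\rangle_{T'}=\{\Gamma_{T'}^{(t,y)}\}$ for variables $x,y$ and $t\in\mathrm{Pat}(\mathcal{P})$; $\langle x,\bot\rangle_{T'}=\{\Gamma_{T'}^{(x,\bot)}\}$, $\langle\bot,y\rangle_{T'}=\{\Gamma_{T'}^{(\bot,y)}\}$; $\langle A,A\rangle_{T'}=\{[A,A]\}$, $\langle A,\bot\rangle_{T'}=\{[A,\bot]\}$, $\langle\bot,A\rangle_{T'}=\{[\bot,A]\}$ (three special non-terminals); $\langle\bot,g(t_1..t_n)\rangle_{T'}=\{\langle\bot,g\rangle(u_1..u_n)\mid u_i\in\langle\bot,t_i\rangle_{T'}\text{ for all }i\}$;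 $\langle f(s_1..s_m),\bot\rangle_{T'}=\{\langle f,\bot\rangle(u_1..u_m)\mid u_i\in\langle s_i,\bot\rangle_{T'}\}$; $\langle A,g(t_1..t_n)\rangle_{T'}$ is the set of all $\langle f,g\rangle(u_1,\dots)$ for $f/m\in\mathcal{C}$ where, if $m<n$, $u_i\in\langle A,t_i\rangle_{T'}$ ($i\le m$) and $u_{j}\in\langle\bot,t_{j}\rangle_{T'}$ ($m<j\le n$), and if $m\ge n$, $u_i\in\langle A,t_i\rangle_{T'}$ ($i\le n$) and $u_j\in\langle A,\bot\rangle_{T'}$ ($n<j\le m$); $\langle f(s_1..s_m),A\rangle_{T'}$ is the set of all $\langle f,g\rangle(u_1,\dots)$ for $g/n\in\mathcal{C}$ where, if $m<n$, $u_i\in\langle s_i,A\rangle_{T'}$ ($i\le m$) and $u_j\in\langle\bot,A\rangle_{T'}$ ($m<j\le n$), and if $m\ge n$, $u_i\in\langle s_i,A\rangle_{T'}$ ($i\le n$) and $u_j\in\langle s_j,\bot\rangle_{T'}$ ($n<j\le m$); $\langle f(s_1..s_m),g(t_1..t_n)\rangle_{T'}$ is the set of $\langle f,g\rangle(u_1,\dots)$ with $u_i\in\langle s_i,t_i\rangle_{T'}$ for $i\le\min(m,n)$ and the remaining arguments in $\langle\bot,t_j\rangle_{T'}$ (if $m<n$) or $\langle s_j,\bot\rangle_{T'}$ (if $m\ge n$). $\mathcal{R}an(\mathcal{G},T,x_1,x_2)$ is the regular tree grammar with initial non-terminal $\Gamma_T^{(x_1,x_2)}$, non-terminals $\Gamma_{T'}^{(x,y)},\Gamma_{T'}^{(x,t)},\Gamma_{T'}^{(t,y)}$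 ($x,y\in\mathrm{Vars}(\mathcal{N})$, $\Gamma_{T'}\in\mathcal{N}$, $t\in\mathrm{Pat}(\mathcal{P})\cup\{\bot\}$) and $[A,A],[A,\bot],[\bot,A]$, and rules: (i) $\Gamma_{T'}^{(t_1,t_2)}\to u$ for each rule $\Gamma_{T'}\to\theta$ of $\mathcal{P}$ and each $u\in\langle\xi_A\theta(t_1),\xi_A\theta(t_2)\rangle_{\top}$, where $\xi_A$ maps every variable of $\theta(t_1),\theta(t_2)$ to $A$; (ii) $\Gamma_{T'}^{(t_1,t_2)}\to u$ for each rule $\Gamma_{T'}\to\textsc{rec}(\Gamma_{T''},\delta)\bullet\theta$ of $\mathcal{P}$ and each $u\in\langle\xi_A\delta\theta(t_1),\xi_A\delta\theta(t_2)\rangle_{T''}$, where $\xi_A$ maps every variable of $\delta\theta(t_1),\delta\theta(t_2)$ not in $\mathcal{V}ar(T'')$ to $A$; (iii) $[A,A]\to u$ for all $f/m,g/n\in\mathcal{C}$ and $u\in\langle f(A,..,A),g(A,..,A)\rangle_{\top}$; $[A,\bot]\to u$ for $f\in\mathcal{C}$, $u\in\langle f(A,..,A),\bot\rangle_{\top}$; $[\bot,A]\to u$ for $g\in\mathcal{C}$, $u\in\langle\bot,g(A,..,A)\rangle_{\top}$.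
   Formalization: Adds the assumption that for every reachable rule Γ_{T'}→rec(Γ_{T''},δ)•θ the variables of VRan(θ) do not occur in Var(T''); without it the claim fails, e.g. for Γ_T→rec(Γ_{T''},{z↦y})•{x↦c(y)}, Γ_{T''}→{y↦a} with a further constant b. *)

theory Defs
  imports Main "HOL-Library.Countable_Set"
begin

section \<open>Terms, positions and substitutions\<close>

datatype (funs: 'f, vars: 'v) trm = Var 'v | Fun 'f "('f, 'v) trm list"

text \<open>\<open>terms C ar V\<close> is the set of well-formed terms over the constructors \<open>C\<close> (with arities
  \<open>ar\<close>) and the variables in \<open>V\<close>; \<open>terms C ar {}\<close> are the ground constructor terms.\<close>

inductive_set terms :: "'f set \<Rightarrow> ('f \<Rightarrow> nat) \<Rightarrow> 'v set \<Rightarrow> ('f, 'v) trm set"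
  for C :: "'f set" and ar :: "'f \<Rightarrow> nat" and V :: "'v set"
where
  "x \<in> V \<Longrightarrow> Var x \<in> terms C ar V"
| "f \<in> C \<Longrightarrow> length ts = ar f \<Longrightarrow> \<forall>t \<in> set ts. t \<in> terms C ar V \<Longrightarrow> Fun f ts \<in> terms C ar V"

lemma size_nth_less [termination_simp]: "i < length ts \<Longrightarrow> size (ts ! i) < Suc (size_list size ts)"
  by (rule le_imp_less_Suc) (rule size_list_estimation'[OF nth_mem order_refl])

fun poss :: "('f, 'v) trm \<Rightarrow> nat list set" where
  "poss (Var x) = {[]}"
| "poss (Fun f ts) = {[]} \<union> (\<Union>i \<in> {..<length ts}. (#) i ` poss (ts ! i))"

fun subt_at :: "('f, 'v) trm \<Rightarrow> nat list \<Rightarrow> ('f, 'v) trm" where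
  "subt_at t [] = t"
| "subt_at (Fun f ts) (i # p) = subt_at (ts ! i) p"

definition subterms :: "('f, 'v) trm \<Rightarrow> ('f, 'v) trm set" where
  "subterms s = {subt_at s p | p. p \<in> poss s}"

type_synonym ('f, 'v) subst = "'v \<Rightarrow> ('f, 'v) trm"

primrec app :: "('v \<Rightarrow> ('f, 'w) trm) \<Rightarrow> ('f, 'v) trm \<Rightarrow> ('f, 'w) trm" where
  "app \<sigma> (Var x) = \<sigma> x"
| "app \<sigma> (Fun f ts) = Fun f (map (app \<sigma>) ts)"

definition sdom :: "('f, 'v) subst \<Rightarrow> 'v set" where
  "sdom \<sigma> = {x. \<sigma> x \<noteq> Var x}"

definition sran :: "('f, 'v) subst \<Rightarrow> ('f, 'v) trm set" where
  "sran \<sigma> = \<sigma> ` sdom \<sigma>"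

definition vran :: "('f, 'v) subst \<Rightarrow> 'v set" where
  "vran \<sigma> = (\<Union>x \<in> sdom \<sigma>. vars (\<sigma> x))"

text \<open>Composition applies the right substitution first.\<close>

definition comp :: "('f, 'v) subst \<Rightarrow> ('f, 'v) subst \<Rightarrow> ('f, 'v) subst" where
  "comp \<theta> \<sigma> = (\<lambda>x. app \<theta> (\<sigma> x))"

definition restr :: "('f, 'v) subst \<Rightarrow> 'v set \<Rightarrow> ('f, 'v) subst" where
  "restr \<sigma> X = (\<lambda>x. if x \<in> X then \<sigma> x else Var x)"

definition idem :: "('f, 'v) subst \<Rightarrow> bool" where
  "idem \<sigma> \<longleftrightarrow> comp \<sigma> \<sigma> = \<sigma>"

text \<open>A renaming is a variable substitution that is injective on its domain. It need not be a
  permutation of the variables; a permutation would be idempotent only if it were the identity.\<close>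

definition renaming :: "('f, 'v) subst \<Rightarrow> bool" where
  "renaming \<rho> \<longleftrightarrow> sran \<rho> \<subseteq> range Var \<and> inj_on \<rho> (sdom \<rho>)"

definition substs :: "'f set \<Rightarrow> ('f \<Rightarrow> nat) \<Rightarrow> ('f, 'v) subst set" where
  "substs C ar = {\<sigma>. finite (sdom \<sigma>) \<and> sran \<sigma> \<subseteq> terms C ar UNIV}"

definition ground_substs :: "'f set \<Rightarrow> ('f \<Rightarrow> nat) \<Rightarrow> ('f, 'v) subst set" where
  "ground_substs C ar = {\<sigma>. finite (sdom \<sigma>) \<and> sran \<sigma> \<subseteq> terms C ar {}}"

definition unifier :: "('f, 'v) subst \<Rightarrow> (('f, 'v) trm \<times> ('f, 'v) trm) set \<Rightarrow> bool" where
  "unifier \<sigma> E \<longleftrightarrow> (\<forall>(s, t) \<in> E. app \<sigma> s = app \<sigma> t)"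

definition is_mgu :: "('f, 'v) subst \<Rightarrow> (('f, 'v) trm \<times> ('f, 'v) trm) set \<Rightarrow> bool" where
  "is_mgu \<sigma> E \<longleftrightarrow> unifier \<sigma> E \<and> (\<forall>\<tau>. unifier \<tau> E \<longrightarrow> (\<exists>\<eta>. \<tau> = comp \<eta> \<sigma>))"


section \<open>Regular tree grammars\<close>

text \<open>Sentential forms are terms whose leaves \<open>Var n\<close> are the non-terminal constants \<open>n\<close>.\<close>

record ('s, 'n) rtg =
  start :: 'n
  nts :: "'n set"
  rules :: "('n \<times> ('s, 'n) trm) set"

definition wf_rtg :: "('s, 'n) rtg \<Rightarrow> bool" where
  "wf_rtg G \<longleftrightarrow> finite (nts G) \<and> finite (rules G) \<and> start G \<in> nts G \<and>
     (\<forall>(n, \<beta>) \<in> rules G. n \<in> nts G \<and> vars \<beta> \<subseteq> nts G)"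

inductive step :: "('s, 'n) rtg \<Rightarrow> ('s, 'n) trm \<Rightarrow> ('s, 'n) trm \<Rightarrow> bool" for G where
  "(n, \<beta>) \<in> rules G \<Longrightarrow> step G (Var n) \<beta>"
| "step G s t \<Longrightarrow> step G (Fun f (us @ s # vs)) (Fun f (us @ t # vs))"

definition lang :: "('s, 'n) rtg \<Rightarrow> 'n \<Rightarrow> ('s, 'n) trm set" where
  "lang G n = {t. (step G)\<^sup>*\<^sup>* (Var n) t \<and> vars t = {}}"

definition reachable :: "('s, 'n) rtg \<Rightarrow> 'n \<Rightarrow> 'n \<Rightarrow> bool" where
  "reachable G = (\<lambda>m n. \<exists>\<beta>. (m, \<beta>) \<in> rules G \<and> n \<in> vars \<beta>)\<^sup>*\<^sup>*"


section \<open>Substitution expressions and their semantics\<close>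

text \<open>Goal clauses are conjunctions of pairs of terms. The symbol type \<open>'f\<close> may contain more symbols
  than the constructors, so goal clauses may mention, e.g., defined symbols.\<close>

datatype (gfuns: 'f, gvars: 'v) goal =
  Top
| Eqn "('f, 'v) trm" "('f, 'v) trm"
| Conj "('f, 'v) goal" "('f, 'v) goal"

datatype ('f, 'v) ssym = Sub "('f, 'v) subst" | Empty | Comp | Par | Rec

type_synonym ('f, 'v, 'n) sexp = "(('f, 'v) ssym, 'n) trm"

abbreviation sub_e :: "('f, 'v) subst \<Rightarrow> ('f, 'v, 'n) sexp" where
  "sub_e \<theta> \<equiv> Fun (Sub \<theta>) []"

abbreviation comp_e :: "('f, 'v, 'n) sexp \<Rightarrow> ('f, 'v, 'n) sexp \<Rightarrow> ('f, 'v, 'n) sexp" where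
  "comp_e e1 e2 \<equiv> Fun Comp [e1, e2]"

abbreviation par_e :: "('f, 'v, 'n) sexp \<Rightarrow> ('f, 'v, 'n) sexp \<Rightarrow> ('f, 'v, 'n) sexp" where
  "par_e e1 e2 \<equiv> Fun Par [e1, e2]"

abbreviation rec_e :: "('f, 'v, 'n) sexp \<Rightarrow> ('f, 'v) subst \<Rightarrow> ('f, 'v, 'n) sexp" where
  "rec_e e \<delta> \<equiv> Fun Rec [e, sub_e \<delta>]"

definition subst_vars :: "('f, 'v) subst set \<Rightarrow> 'v set" where
  "subst_vars S = (\<Union>\<sigma> \<in> S. sdom \<sigma> \<union> vran \<sigma>)"

text \<open>\<open>renamed_apart S \<sigma> \<delta> \<sigma>'\<close> states that \<open>\<sigma>'\<close> is an admissible choice for the renamed substitution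
  written \<open>\<sigma>\<close> with exponent \<open>\<delta>\<close>; \<open>S\<close> are the substitutions of the signature.\<close>

definition renamed_apart ::
  "('f, 'v) subst set \<Rightarrow> ('f, 'v) subst \<Rightarrow> ('f, 'v) subst \<Rightarrow> ('f, 'v) subst \<Rightarrow> bool" where
  "renamed_apart S \<sigma> \<delta> \<sigma>' \<longleftrightarrow>
     (\<exists>\<xi>. renaming \<xi> \<and> sdom \<xi> = vran \<sigma> \<and>
          vran \<xi> \<inter> (sdom \<delta> \<union> vran \<delta> \<union> sdom \<sigma> \<union> subst_vars S) = {} \<and>
          \<sigma>' = restr (comp \<xi> \<sigma>) (sdom \<sigma>))"

definition par_comp :: "('f, 'v) subst \<Rightarrow> ('f, 'v) subst \<Rightarrow> ('f, 'v) subst \<Rightarrow> bool" where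
  "par_comp \<theta>1 \<theta>2 \<sigma> \<longleftrightarrow> idem \<theta>1 \<and> idem \<theta>2 \<and> idem \<sigma> \<and>
     is_mgu \<sigma> ({(Var x, \<theta>1 x) | x. True} \<union> {(Var x, \<theta>2 x) | x. True}) \<and>
     sdom \<theta>1 \<union> sdom \<theta>2 \<subseteq> sdom \<sigma>"

text \<open>\<open>sem S e \<theta>\<close>: the expression \<open>e\<close> denotes the substitution \<open>\<theta>\<close>. Failure is the absence of a
  value. The semantics leaves the renaming and the most general unifier open; the relation
  contains the value for every admissible choice of these.\<close>

inductive sem :: "('f, 'v) subst set \<Rightarrow> ('f, 'v, 'n) sexp \<Rightarrow> ('f, 'v) subst \<Rightarrow> bool" for S where
  "sem S (sub_e \<theta>) \<theta>"
| "sem S e1 \<theta>1 \<Longrightarrow> sem S e2 \<theta>2 \<Longrightarrow> sem S (comp_e e1 e2) (comp \<theta>1 \<theta>2)"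
| "sem S e1 \<theta>1 \<Longrightarrow> sem S e2 \<sigma>2 \<Longrightarrow> renamed_apart S \<sigma>2 \<theta>1 \<theta>2 \<Longrightarrow> par_comp \<theta>1 \<theta>2 \<sigma> \<Longrightarrow>
   sem S (par_e e1 e2) (restr \<sigma> (sdom \<theta>1 \<union> sdom \<theta>2))"
| "sem S e \<sigma> \<Longrightarrow> vran \<delta> \<subseteq> sdom \<sigma> \<Longrightarrow> renamed_apart S \<sigma> \<delta> \<sigma>' \<Longrightarrow>
   sem S (rec_e e \<delta>) (restr (comp \<sigma>' \<delta>) (sdom \<delta>))"


section \<open>Substitution-set grammars\<close>

text \<open>The non-terminal indexed by a goal clause is represented by the goal clause itself.
  \<open>ssg_rhs S N \<beta>\<close>: \<open>\<beta>\<close> is a substitution expression over the substitutions \<open>S\<close> in which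
  non-terminals (from \<open>N\<close>) occur only as first arguments of \<open>Rec\<close>.\<close>

inductive ssg_rhs ::
  "('f, 'v) subst set \<Rightarrow> ('f, 'v) goal set \<Rightarrow> ('f, 'v, ('f, 'v) goal) sexp \<Rightarrow> bool" for S N where
  "\<theta> \<in> S \<Longrightarrow> ssg_rhs S N (sub_e \<theta>)"
| "ssg_rhs S N (Fun Empty [])"
| "ssg_rhs S N e1 \<Longrightarrow> ssg_rhs S N e2 \<Longrightarrow> ssg_rhs S N (comp_e e1 e2)"
| "ssg_rhs S N e1 \<Longrightarrow> ssg_rhs S N e2 \<Longrightarrow> ssg_rhs S N (par_e e1 e2)"
| "ssg_rhs S N e \<Longrightarrow> \<delta> \<in> S \<Longrightarrow> idem \<delta> \<Longrightarrow> renaming \<delta> \<Longrightarrow> ssg_rhs S N (rec_e e \<delta>)"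
| "T \<in> N \<Longrightarrow> \<delta> \<in> S \<Longrightarrow> idem \<delta> \<Longrightarrow> renaming \<delta> \<Longrightarrow>
   vran \<delta> \<subseteq> gvars T \<Longrightarrow> sdom \<delta> \<inter> (gvars T - vran \<delta>) = {} \<Longrightarrow> ssg_rhs S N (rec_e (Var T) \<delta>)"

type_synonym ('f, 'v) grammar = "(('f, 'v) ssym, ('f, 'v) goal) rtg"

definition ssg :: "'f set \<Rightarrow> ('f \<Rightarrow> nat) \<Rightarrow> ('f, 'v) subst set \<Rightarrow> ('f, 'v) grammar \<Rightarrow> bool" where
  "ssg C ar S G \<longleftrightarrow> finite S \<and> S \<subseteq> {\<sigma> \<in> substs C ar. idem \<sigma>} \<and> wf_rtg G \<and>
     (\<forall>(T, \<beta>) \<in> rules G. ssg_rhs S (nts G) \<beta>)"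

definition Substs ::
  "('f, 'v) subst set \<Rightarrow> ('f, 'v) grammar \<Rightarrow> ('f, 'v) goal \<Rightarrow> ('f, 'v) subst set" where
  "Substs S G T = {\<theta>. \<exists>e \<in> lang G T. sem S e \<theta>}"

text \<open>A right-hand side consisting of \<open>Rec\<close> only is read as one with the identity substitution.\<close>

definition rec_rhs ::
  "('f, 'v, ('f, 'v) goal) sexp \<Rightarrow> ('f, 'v) goal \<Rightarrow> ('f, 'v) subst \<Rightarrow> ('f, 'v) subst \<Rightarrow> bool" where
  "rec_rhs \<beta> T \<delta> \<theta> \<longleftrightarrow>
     \<beta> = comp_e (rec_e (Var T) \<delta>) (sub_e \<theta>) \<or> \<beta> = rec_e (Var T) \<delta> \<and> \<theta> = Var"

text \<open>As \<open>x\<close> and \<open>y\<close> range over all variables of \<open>T'\<close>, the condition covers both orders.\<close>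

definition compatible ::
  "'f set \<Rightarrow> ('f \<Rightarrow> nat) \<Rightarrow> ('f, 'v) goal \<Rightarrow> ('f, 'v) goal \<Rightarrow> ('f, 'v) subst \<Rightarrow> ('f, 'v) subst \<Rightarrow> bool"
where
  "compatible C ar T' T'' \<delta> \<theta> \<longleftrightarrow>
     (\<forall>x \<in> gvars T'. \<forall>y \<in> gvars T'. \<forall>p \<in> poss (comp \<delta> \<theta> x) \<inter> poss (comp \<delta> \<theta> y).
        subt_at (comp \<delta> \<theta> x) p \<in> Var ` gvars T'' \<longrightarrow>
        subt_at (comp \<delta> \<theta> y) p \<in> Var ` gvars T'' \<union> terms C ar (- gvars T''))"

definition shape_assumption ::
  "'f set \<Rightarrow> ('f \<Rightarrow> nat) \<Rightarrow> ('f, 'v) grammar \<Rightarrow> ('f, 'v) goal \<Rightarrow> bool" where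
  "shape_assumption C ar G T \<longleftrightarrow>
     (\<forall>T' \<beta>. reachable G T T' \<and> (T', \<beta>) \<in> rules G \<longrightarrow>
        (\<exists>\<theta>. \<beta> = sub_e \<theta> \<and> idem \<theta> \<and> sdom \<theta> = gvars T') \<or>
        (\<exists>T'' \<delta> \<theta>. rec_rhs \<beta> T'' \<delta> \<theta> \<and> idem \<theta> \<and> sdom \<theta> = gvars T' \<and> vran \<delta> = gvars T'' \<and>
           compatible C ar T' T'' \<delta> \<theta>))"

text \<open>The variables introduced by \<open>\<theta>\<close> do not clash with the variables of the goal clause called by
  \<open>Rec\<close>. Without this, a variable of \<open>\<theta>\<close> outside \<open>sdom \<delta>\<close>, which stays free in the denoted
  substitution, would be confused with an equally named variable of that goal clause in the
  grammar constructed below.\<close>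

definition fresh_ranges :: "('f, 'v) grammar \<Rightarrow> ('f, 'v) goal \<Rightarrow> bool" where
  "fresh_ranges G T \<longleftrightarrow>
     (\<forall>T' \<beta> T'' \<delta> \<theta>. reachable G T T' \<and> (T', \<beta>) \<in> rules G \<and> rec_rhs \<beta> T'' \<delta> \<theta> \<longrightarrow>
        vran \<theta> \<inter> gvars T'' = {})"


section \<open>Coding of pairs of ground terms\<close>

datatype 'f ext = Con 'f | A | Bot

fun code_bot_left :: "('f, 'v) trm \<Rightarrow> ('f ext \<times> 'f ext, 'n) trm" where
  "code_bot_left (Fun g ts) = Fun (Bot, Con g) (map code_bot_left ts)"

fun code_bot_right :: "('f, 'v) trm \<Rightarrow> ('f ext \<times> 'f ext, 'n) trm" where
  "code_bot_right (Fun f ss) = Fun (Con f, Bot) (map code_bot_right ss)"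

text \<open>Only meant for ground terms; the value on other terms is irrelevant.\<close>

function code :: "('f, 'v) trm \<Rightarrow> ('f, 'v) trm \<Rightarrow> ('f ext \<times> 'f ext, 'n) trm" where
  "code (Fun f ss) (Fun g ts) = Fun (Con f, Con g)
     (map (\<lambda>(s, t). code s t) (zip ss ts) @
      (if length ss \<le> length ts then map code_bot_left (drop (length ss) ts)
       else map code_bot_right (drop (length ts) ss)))"
| "code (Var x) t = undefined"
| "code (Fun f ss) (Var y) = undefined"
  by pat_completeness auto
termination
  by (relation "Wellfounded.measure (\<lambda>(s, t). size s)")
     (force simp: set_zip intro: add_strict_mono size_nth_less)+


section \<open>The grammar for pairs of ranges\<close>

abbreviation A_t :: "('f ext, 'v) trm" where "A_t \<equiv> Fun A []"
abbreviation Bot_t :: "('f ext, 'v) trm" where "Bot_t \<equiv> Fun Bot []"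

definition emb :: "('f, 'v) trm \<Rightarrow> ('f ext, 'v) trm" where
  "emb = map_trm Con (\<lambda>x. x)"

text \<open>Application of a substitution to a term that may contain the constants \<open>A\<close> and \<open>Bot\<close>.\<close>

definition app_ext :: "('f, 'v) subst \<Rightarrow> ('f ext, 'v) trm \<Rightarrow> ('f ext, 'v) trm" where
  "app_ext \<theta> = app (\<lambda>x. emb (\<theta> x))"

text \<open>Replaces all variables outside \<open>V\<close> by \<open>A\<close>.\<close>

definition abstr :: "'v set \<Rightarrow> ('f ext, 'v) trm \<Rightarrow> ('f ext, 'v) trm" where
  "abstr V = app (\<lambda>x. if x \<in> V then Var x else A_t)"

definition Pat :: "('f, 'v) grammar \<Rightarrow> ('f ext, 'v) trm set" where
  "Pat G = {abstr {} (emb t) | t s \<theta> n \<beta>.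
     (n, \<beta>) \<in> rules G \<and> Sub \<theta> \<in> funs \<beta> \<and> s \<in> sran \<theta> \<and> t \<in> subterms s}"

definition Vars :: "('f, 'v) grammar \<Rightarrow> 'v set" where
  "Vars G = (\<Union>T \<in> nts G. gvars T)"

datatype ('f, 'v) rnt =
  Gam "('f, 'v) goal" "('f ext, 'v) trm" "('f ext, 'v) trm"
| AA | ABot | BotA

text \<open>\<open>pairing C ar P T s t u\<close>: \<open>u\<close> is an element of the set of right-hand sides for the pair of
  \<open>s\<close> and \<open>t\<close> with respect to the goal clause \<open>T\<close> and the patterns \<open>P\<close>.\<close>

inductive pairing :: "'f set \<Rightarrow> ('f \<Rightarrow> nat) \<Rightarrow> ('f ext, 'v) trm set \<Rightarrow> ('f, 'v) goal \<Rightarrow>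
    ('f ext, 'v) trm \<Rightarrow> ('f ext, 'v) trm \<Rightarrow> ('f ext \<times> 'f ext, ('f, 'v) rnt) trm \<Rightarrow> bool"
  for C ar P T
where
  "pairing C ar P T (Var x) (Var y) (Var (Gam T (Var x) (Var y)))"
| "t \<in> P \<Longrightarrow> pairing C ar P T (Var x) t (Var (Gam T (Var x) t))"
| "t \<in> P \<Longrightarrow> pairing C ar P T t (Var y) (Var (Gam T t (Var y)))"
| "pairing C ar P T (Var x) Bot_t (Var (Gam T (Var x) Bot_t))"
| "pairing C ar P T Bot_t (Var y) (Var (Gam T Bot_t (Var y)))"
| "pairing C ar P T A_t A_t (Var AA)"
| "pairing C ar P T A_t Bot_t (Var ABot)"
| "pairing C ar P T Bot_t A_t (Var BotA)"
| "length us = length ts \<Longrightarrow>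
   (\<forall>i < length ts. pairing C ar P T Bot_t (ts ! i) (us ! i)) \<Longrightarrow>
   pairing C ar P T Bot_t (Fun (Con g) ts) (Fun (Bot, Con g) us)"
| "length us = length ss \<Longrightarrow>
   (\<forall>i < length ss. pairing C ar P T (ss ! i) Bot_t (us ! i)) \<Longrightarrow>
   pairing C ar P T (Fun (Con f) ss) Bot_t (Fun (Con f, Bot) us)"
| "f \<in> C \<Longrightarrow> length us = max (ar f) (length ts) \<Longrightarrow>
   (\<forall>i. i < ar f \<and> i < length ts \<longrightarrow> pairing C ar P T A_t (ts ! i) (us ! i)) \<Longrightarrow>
   (\<forall>i. ar f \<le> i \<and> i < length ts \<longrightarrow> pairing C ar P T Bot_t (ts ! i) (us ! i)) \<Longrightarrow>
   (\<forall>i. length ts \<le> i \<and> i < ar f \<longrightarrow> pairing C ar P T A_t Bot_t (us ! i)) \<Longrightarrow>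
   pairing C ar P T A_t (Fun (Con g) ts) (Fun (Con f, Con g) us)"
| "g \<in> C \<Longrightarrow> length us = max (length ss) (ar g) \<Longrightarrow>
   (\<forall>i. i < length ss \<and> i < ar g \<longrightarrow> pairing C ar P T (ss ! i) A_t (us ! i)) \<Longrightarrow>
   (\<forall>i. length ss \<le> i \<and> i < ar g \<longrightarrow> pairing C ar P T Bot_t A_t (us ! i)) \<Longrightarrow>
   (\<forall>i. ar g \<le> i \<and> i < length ss \<longrightarrow> pairing C ar P T (ss ! i) Bot_t (us ! i)) \<Longrightarrow>
   pairing C ar P T (Fun (Con f) ss) A_t (Fun (Con f, Con g) us)"
| "length us = max (length ss) (length ts) \<Longrightarrow>
   (\<forall>i. i < length ss \<and> i < length ts \<longrightarrow> pairing C ar P T (ss ! i) (ts ! i) (us ! i)) \<Longrightarrow>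
   (\<forall>i. length ss \<le> i \<and> i < length ts \<longrightarrow> pairing C ar P T Bot_t (ts ! i) (us ! i)) \<Longrightarrow>
   (\<forall>i. length ts \<le> i \<and> i < length ss \<longrightarrow> pairing C ar P T (ss ! i) Bot_t (us ! i)) \<Longrightarrow>
   pairing C ar P T (Fun (Con f) ss) (Fun (Con g) ts) (Fun (Con f, Con g) us)"

definition Ran_nts :: "('f, 'v) grammar \<Rightarrow> ('f, 'v) rnt set" where
  "Ran_nts G =
     {Gam T (Var x) (Var y) | T x y. T \<in> nts G \<and> x \<in> Vars G \<and> y \<in> Vars G} \<union>
     {Gam T (Var x) t | T x t. T \<in> nts G \<and> x \<in> Vars G \<and> t \<in> Pat G \<union> {Bot_t}} \<union>
     {Gam T t (Var y) | T t y. T \<in> nts G \<and> y \<in> Vars G \<and> t \<in> Pat G \<union> {Bot_t}} \<union>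
     {AA, ABot, BotA}"

definition Ran :: "'f set \<Rightarrow> ('f \<Rightarrow> nat) \<Rightarrow> ('f, 'v) grammar \<Rightarrow> ('f, 'v) goal \<Rightarrow> 'v \<Rightarrow> 'v \<Rightarrow>
    ('f ext \<times> 'f ext, ('f, 'v) rnt) rtg" where
  "Ran C ar G T x1 x2 =
     \<lparr> start = Gam T (Var x1) (Var x2),
       nts = Ran_nts G,
       rules =
         {(Gam T' t1 t2, u) | T' t1 t2 \<theta> u.
            Gam T' t1 t2 \<in> Ran_nts G \<and> (T', sub_e \<theta>) \<in> rules G \<and>
            pairing C ar (Pat G) Top (abstr {} (app_ext \<theta> t1)) (abstr {} (app_ext \<theta> t2)) u} \<union>
         {(Gam T' t1 t2, u) | T' t1 t2 \<beta> T'' \<delta> \<theta> u.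
            Gam T' t1 t2 \<in> Ran_nts G \<and> (T', \<beta>) \<in> rules G \<and> rec_rhs \<beta> T'' \<delta> \<theta> \<and>
            pairing C ar (Pat G) T'' (abstr (gvars T'') (app_ext (comp \<delta> \<theta>) t1))
              (abstr (gvars T'') (app_ext (comp \<delta> \<theta>) t2)) u} \<union>
         {(AA, u) | f g u. f \<in> C \<and> g \<in> C \<and>
            pairing C ar (Pat G) Top (Fun (Con f) (replicate (ar f) A_t))
              (Fun (Con g) (replicate (ar g) A_t)) u} \<union>
         {(ABot, u) | f u. f \<in> C \<and>
            pairing C ar (Pat G) Top (Fun (Con f) (replicate (ar f) A_t)) Bot_t u} \<union>
         {(BotA, u) | g u. g \<in> C \<and>
            pairing C ar (Pat G) Top Bot_t (Fun (Con g) (replicate (ar g) A_t)) u} \<rparr>"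

end

theory Submission
  imports Defs
begin

text \<open>The claim is strengthened in two ways. First, \<open>\<xi>\<close> is replaced by a choice of a ground
  term for every single occurrence of a variable, which is the reading of \<open>A\<close> in the grammar;
  hence it does not matter that equal variables are forgotten. Second, all non-terminals
  \<open>Gam T' p q\<close> are treated, also those where \<open>p\<close> or \<open>q\<close> is a pattern or \<open>\<bottom>\<close>:
  they generate the codes of all pairs of instances of \<open>\<theta>(p)\<close> and \<open>\<theta>(q)\<close>. The proof is by
  induction on the substitution expression. For a rule with \<open>Rec\<close>, the given pair of terms is
  followed in parallel with the two abstracted right-hand sides until a variable of the called
  goal clause is met on one side. The compatibility condition ensures that the other side is then
  again a variable of that goal clause or abstracts to a pattern, so that the induction hypothesis
  applies.\<close>

section \<open>Derivations in regular tree grammars\<close>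

lemma steps_Fun:
  assumes "length us = length ts" "\<And>i. i < length ts \<Longrightarrow> (step R)\<^sup>*\<^sup>* (us ! i) (ts ! i)"
  shows "(step R)\<^sup>*\<^sup>* (Fun f us) (Fun f ts)"
proof -
  have arg: "(step R)\<^sup>*\<^sup>* (Fun f (as @ s # bs)) (Fun f (as @ t # bs))" if "(step R)\<^sup>*\<^sup>* s t" for as bs s t
    using that by (induction rule: rtranclp_induct) (auto intro: rtranclp.rtrancl_into_rtrancl step.intros(2))
  have "list_all2 ((step R)\<^sup>*\<^sup>*) us ts"
    using assms by (simp add: list_all2_conv_all_nth)
  \<comment> \<open>The prefix \<open>as\<close> collects the arguments already rewritten, so it
    must vary in the induction along the argument list.\<close>
  then have "(step R)\<^sup>*\<^sup>* (Fun f (as @ us)) (Fun f (as @ ts))" for as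
  proof (induction arbitrary: as rule: list_all2_induct)
    case (Cons u us t ts)
    from arg[OF Cons(1), of as us] Cons(3)[of "as @ [t]"] show ?case by simp
  qed simp
  from this[of "[]"] show ?thesis by simp
qed

text \<open>Rules rewrite only leaves \<open>Var n\<close>, so a root symbol once produced survives
  and its arguments evolve independently. This recovers the shape of a generated expression from a
  right-hand side.\<close>

lemma steps_FunE:
  assumes "(step R)\<^sup>*\<^sup>* (Fun f us) t"
  obtains ts where "t = Fun f ts" "list_all2 ((step R)\<^sup>*\<^sup>*) us ts"
proof -
  from assms have "\<exists>ts. t = Fun f ts \<and> list_all2 ((step R)\<^sup>*\<^sup>*) us ts"
  proof (induction rule: rtranclp_induct)
    case base
    show ?case by (auto intro: list_all2_refl)
  next
    case (step y z)
    then obtain ts where ts: "y = Fun f ts" "list_all2 ((step R)\<^sup>*\<^sup>*) us ts" by blast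
    from step(2) ts(1) obtain as s bs s' where
      *: "ts = as @ s # bs" "z = Fun f (as @ s' # bs)" "step R s s'"
      by (auto elim: step.cases)
    from ts(2) obtain us1 u us2 where "us = us1 @ u # us2" "list_all2 ((step R)\<^sup>*\<^sup>*) us1 as"
      "(step R)\<^sup>*\<^sup>* u s" "list_all2 ((step R)\<^sup>*\<^sup>*) us2 bs"
      unfolding *(1) by (auto simp: list_all2_append2 list_all2_Cons2)
    with *(3) have "list_all2 ((step R)\<^sup>*\<^sup>*) us (as @ s' # bs)"
      by (auto intro!: list_all2_appendI rtranclp.rtrancl_into_rtrancl[of _ u s])
    with *(2) show ?case by blast
  qed
  with that show thesis by blast
qed

lemma langE:
  assumes "e \<in> lang G n"
  obtains \<beta> where "(n, \<beta>) \<in> rules G" "(step G)\<^sup>*\<^sup>* \<beta> e" "vars e = {}"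
proof -
  from assms have "(step G)\<^sup>*\<^sup>* (Var n) e" "vars e = {}" by (auto simp: lang_def)
  then show thesis
  proof (cases rule: converse_rtranclpE)
    case (step \<beta>)
    from step(1) have "(n, \<beta>) \<in> rules G" by cases auto
    with step(2) \<open>vars e = {}\<close> show thesis by (rule that[rotated])
  qed auto
qed

section \<open>Positions, subterms, abstraction and patterns\<close>

lemma vars_subt_at: "q \<in> poss p \<Longrightarrow> vars (subt_at p q) \<subseteq> vars p"
  by (induction p q rule: subt_at.induct) force+

text \<open>Variables and the constant \<open>A\<close> have the root as their only position, so
  putting them for variables moves no position. Serves abstraction and renamings alike.\<close>

lemma poss_subt_at_app:
  assumes "\<And>v. poss (\<tau> v) = {[]}"
  shows "poss (app \<tau> t) = poss t"
    and "q \<in> poss t \<Longrightarrow> subt_at (app \<tau> t) q = app \<tau> (subt_at t q)"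
proof -
  show "poss (app \<tau> t) = poss t"
    by (induction t) (auto simp: assms)
  show "q \<in> poss t \<Longrightarrow> subt_at (app \<tau> t) q = app \<tau> (subt_at t q)"
    by (induction t q rule: subt_at.induct) auto
qed

lemma subt_at_append:
  "p \<in> poss s \<Longrightarrow> q \<in> poss (subt_at s p) \<Longrightarrow> p @ q \<in> poss s \<and> subt_at s (p @ q) = subt_at (subt_at s p) q"
  by (induction s p rule: subt_at.induct) auto

lemma subterms_trans: "t \<in> subterms s \<Longrightarrow> r \<in> subterms t \<Longrightarrow> r \<in> subterms s"
  unfolding subterms_def by (auto dest: subt_at_append) (metis subt_at_append)

lemma subterms_nth: "i < length ts \<Longrightarrow> r \<in> subterms (ts ! i) \<Longrightarrow> r \<in> subterms (Fun f ts)"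
proof -
  assume "i < length ts" "r \<in> subterms (ts ! i)"
  then obtain q where "q \<in> poss (ts ! i)" "r = subt_at (ts ! i) q" by (auto simp: subterms_def)
  with \<open>i < length ts\<close> have "i # q \<in> poss (Fun f ts)" "r = subt_at (Fun f ts) (i # q)" by auto
  then show ?thesis unfolding subterms_def by blast
qed

lemma subterms_refl: "t \<in> subterms t"
proof -
  have "[] \<in> poss t" by (cases t) auto
  then show ?thesis unfolding subterms_def by force
qed

lemma emb_simps [simp]: "emb (Var x) = Var x" "emb (Fun f ts) = Fun (Con f) (map emb ts)"
  by (simp_all add: emb_def)

lemma emb_app: "emb (app \<sigma> t) = app_ext \<sigma> (emb t)"
  unfolding app_ext_def by (induction t) auto

lemma poss_emb [simp]: "poss (emb t) = poss t"
  by (induction t) auto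

lemma subt_at_emb: "q \<in> poss t \<Longrightarrow> subt_at (emb t) q = emb (subt_at t q)"
  by (induction t q rule: subt_at.induct) auto

lemma vars_emb [simp]: "vars (emb t) = vars t"
  by (induction t) auto

lemma app_cong: "(\<And>x. x \<in> vars t \<Longrightarrow> \<sigma> x = \<tau> x) \<Longrightarrow> app \<sigma> t = app \<tau> t"
  by (induction t) auto

lemma app_app: "app \<sigma> (app \<tau> t) = app (\<lambda>x. app \<sigma> (\<tau> x)) t"
  by (induction t) auto

lemma app_Var [simp]: "app Var t = t"
  by (induction t) (auto simp: map_idI)

lemma vars_app: "vars (app \<sigma> t) = (\<Union>x \<in> vars t. vars (\<sigma> x))"
  by (induction t) auto

lemma vars_abstr: "vars (abstr V t) = vars t \<inter> V"
  by (auto simp: abstr_def vars_app split: if_splits)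

text \<open>Patterns are formed with \<open>abstr {}\<close>, right-hand sides with
  \<open>abstr V\<close>; once no variable survives, the two agree.\<close>

lemma abstr_ground: "vars (abstr V t) = {} \<Longrightarrow> abstr V t = abstr {} t"
  unfolding vars_abstr unfolding abstr_def by (rule app_cong) auto

lemma poss_abstr [simp]: "poss (abstr V t) = poss t"
  unfolding abstr_def by (rule poss_subt_at_app) auto

lemma subt_at_abstr: "q \<in> poss t \<Longrightarrow> subt_at (abstr V t) q = abstr V (subt_at t q)"
  unfolding abstr_def by (rule poss_subt_at_app) auto

lemma terms_vars: "t \<in> terms C ar V \<Longrightarrow> vars t \<subseteq> V"
  by (induction rule: terms.induct) auto

lemma renaming_Var: "renaming \<rho> \<Longrightarrow> \<exists>w. \<rho> v = Var w"
  by (cases "v \<in> sdom \<rho>") (auto simp: renaming_def sran_def sdom_def)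

text \<open>Abstraction keeps positions, so a subterm of a pattern abstracts a subterm of some range
  term, and \<open>Pat\<close> ranges over all of these.\<close>

lemma Pat_subterm:
  assumes "t \<in> Pat G" "r \<in> subterms t" shows "r \<in> Pat G"
proof -
  from assms(1) obtain t0 s \<theta> n \<beta> where t: "t = abstr {} (emb t0)" "(n, \<beta>) \<in> rules G" "Sub \<theta> \<in> funs \<beta>"
    "s \<in> sran \<theta>" "t0 \<in> subterms s" unfolding Pat_def by blast
  from assms(2) obtain q where q: "q \<in> poss t0" "r = abstr {} (emb (subt_at t0 q))"
    by (auto simp: subterms_def t(1) subt_at_abstr subt_at_emb)
  moreover have "subt_at t0 q \<in> subterms s"
    using q(1) by (intro subterms_trans[OF t(5)]) (auto simp: subterms_def)
  ultimately show ?thesis using t unfolding Pat_def by blast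
qed

lemma vars_Pat: "t \<in> Pat G \<Longrightarrow> vars t = {}"
  by (auto simp: Pat_def vars_abstr)

section \<open>Codes of optional terms\<close>

text \<open>\<open>None\<close> stands for \<open>\<bottom>\<close>, so that one recursion equation, \<open>ocode_unfold\<close>, covers all cases
  of the coding.\<close>

fun root :: "('f, 'v) trm option \<Rightarrow> 'f ext" where
  "root (Some (Fun f ss)) = Con f"
| "root _ = Bot"

fun args :: "('f, 'v) trm option \<Rightarrow> ('f, 'v) trm list" where
  "args (Some (Fun f ss)) = ss"
| "args _ = []"

text \<open>The value \<open>None\<close> beyond the arity realises the padding by \<bottom> in the
  coding of pairs.\<close>

definition arg :: "('f, 'v) trm option \<Rightarrow> nat \<Rightarrow> ('f, 'v) trm option" where
  "arg s i = (if i < length (args s) then Some (args s ! i) else None)"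

definition arity :: "('f, 'v) trm option \<Rightarrow> ('f, 'v) trm option \<Rightarrow> nat" where
  "arity s t = max (length (args s)) (length (args t))"

fun ocode :: "('f, 'v) trm option \<Rightarrow> ('f, 'v) trm option \<Rightarrow> ('f ext \<times> 'f ext, 'n) trm" where
  "ocode (Some s) (Some t) = code s t"
| "ocode (Some s) None = code_bot_right s"
| "ocode None (Some t) = code_bot_left t"
| "ocode None None = undefined"

definition ground :: "'f set \<Rightarrow> ('f \<Rightarrow> nat) \<Rightarrow> ('f, 'v) trm option \<Rightarrow> bool" where
  "ground C ar s \<longleftrightarrow> (\<exists>t \<in> terms C ar {}. s = Some t)"

abbreviation oground :: "'f set \<Rightarrow> ('f \<Rightarrow> nat) \<Rightarrow> ('f, 'v) trm option \<Rightarrow> bool" where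
  "oground C ar s \<equiv> s = None \<or> ground C ar s"

lemma groundE:
  assumes "ground C ar s"
  obtains f ss where "s = Some (Fun f ss)" "f \<in> C" "length ss = ar f"
    "\<forall>i < ar f. ground C ar (Some (ss ! i))"
  using assms unfolding ground_def by (auto elim!: terms.cases)

lemma ground_Fun:
  "ground C ar (Some (Fun f ss)) \<longleftrightarrow>
    f \<in> C \<and> length ss = ar f \<and> (\<forall>i < ar f. ground C ar (Some (ss ! i)))"
proof -
  have "ground C ar (Some (Fun f ss)) \<longleftrightarrow> Fun f ss \<in> terms C ar {}" by (auto simp: ground_def)
  also have "\<dots> \<longleftrightarrow> f \<in> C \<and> length ss = ar f \<and> (\<forall>i < ar f. ground C ar (Some (ss ! i)))"
    by (subst terms.simps) (auto simp: all_set_conv_all_nth ground_def)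
  finally show ?thesis .
qed

lemma ground_root: "ground C ar s \<Longrightarrow> \<exists>f \<in> C. root s = Con f \<and> length (args s) = ar f"
  by (auto elim: groundE)

lemma oground_arg: "oground C ar s \<Longrightarrow> oground C ar (arg s i)"
  by (auto simp: arg_def elim!: groundE)

text \<open>Keeps the undefined case of \<open>ocode\<close>, two absent terms, out of the
  recursion.\<close>

lemma arg_not_None: "i < arity s t \<Longrightarrow> arg s i \<noteq> None \<or> arg t i \<noteq> None"
  by (auto simp: arity_def arg_def less_max_iff_disj)

lemma size_arg: "size_option size (arg s i) \<le> size_option size s"
  "s \<noteq> None \<Longrightarrow> oground C ar s \<Longrightarrow> size_option size (arg s i) < size_option size s"
  by (cases s rule: args.cases; auto simp: arg_def size_nth_less less_imp_le elim: groundE)+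

lemma ocode_unfold:
  assumes "oground C ar s" "oground C ar t" "s \<noteq> None \<or> t \<noteq> None"
  shows "ocode s t = Fun (root s, root t) (map (\<lambda>i. ocode (arg s i) (arg t i)) [0..<arity s t])"
proof (cases s; cases t)
  fix s' t' assume *: "s = Some s'" "t = Some t'"
  then obtain f ss g ts where "s' = Fun f ss" "t' = Fun g ts"
    using assms by (auto elim!: groundE)
  with * show ?thesis
    by (auto simp: arity_def arg_def nth_append min_def max_def intro!: nth_equalityI)
next
  fix s' assume *: "s = Some s'" "t = None"
  then obtain f ss where "s' = Fun f ss" using assms by (auto elim!: groundE)
  with * show ?thesis by (auto simp: arity_def arg_def intro!: nth_equalityI)
next
  fix t' assume *: "s = None" "t = Some t'"
  then obtain f ss where "t' = Fun f ss" using assms by (auto elim!: groundE)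
  with * show ?thesis by (auto simp: arity_def arg_def intro!: nth_equalityI)
qed (use assms in auto)

text \<open>The sum of the sizes decreases: neither side grows, a present side strictly shrinks, and
  at least one side is present.\<close>

lemma ocode_induct [consumes 3, case_names step]:
  assumes "oground C ar s" "oground C ar t" "s \<noteq> None \<or> t \<noteq> None"
  assumes "\<And>s t. oground C ar s \<Longrightarrow> oground C ar t \<Longrightarrow> s \<noteq> None \<or> t \<noteq> None \<Longrightarrow>
    (\<And>i. i < arity s t \<Longrightarrow> Q (arg s i) (arg t i)) \<Longrightarrow> Q s t"
  shows "Q s t"
  using assms(1-3)
proof (induction "size_option size s + size_option size t" arbitrary: s t rule: less_induct)
  case less
  show ?case
  proof (rule assms(4)[OF less.prems])
    fix i assume i: "i < arity s t"
    have "size_option size (arg s i) + size_option size (arg t i) < size_option size s + size_option size t"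
      using less.prems(3) size_arg(1)[of s i] size_arg(1)[of t i] size_arg(2)[OF _ less.prems(1), of i]
        size_arg(2)[OF _ less.prems(2), of i] by linarith
    then show "Q (arg s i) (arg t i)"
      by (rule less.hyps) (intro oground_arg less.prems(1,2) arg_not_None[OF i])+
  qed
qed

lemma vars_ocode:
  assumes "oground C ar s" "oground C ar t" "s \<noteq> None \<or> t \<noteq> None"
  shows "vars (ocode s t) = {}"
  using assms by (induction rule: ocode_induct) (simp add: ocode_unfold)

section \<open>Instances of patterns\<close>

text \<open>The occurrences of \<open>A\<close>, and likewise those of a variable, are instantiated independently of
  each other.\<close>

fun inst :: "'f set \<Rightarrow> ('f \<Rightarrow> nat) \<Rightarrow> ('v \<Rightarrow> ('f, 'w) trm option \<Rightarrow> bool) \<Rightarrow>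
    ('f ext, 'v) trm \<Rightarrow> ('f, 'w) trm option \<Rightarrow> bool" where
  "inst C ar I (Var z) s = I z s"
| "inst C ar I (Fun Bot ps) s = (ps = [] \<and> s = None)"
| "inst C ar I (Fun A ps) s = (ps = [] \<and> ground C ar s)"
| "inst C ar I (Fun (Con f) ps) s = (\<exists>ss. s = Some (Fun f ss) \<and> f \<in> C \<and> length ss = ar f \<and>
     length ps = ar f \<and> (\<forall>i. i < length ps \<longrightarrow> inst C ar I (ps ! i) (Some (ss ! i))))"

text \<open>An equality, and not just one implication, because occurrences are independent: two
  occurrences of \<open>z\<close> may receive different instances of
  \<open>\<tau> z\<close>.\<close>

lemma inst_app: "inst C ar I (app \<tau> p) s = inst C ar (\<lambda>z. inst C ar I (\<tau> z)) p s"
proof (induction p arbitrary: s)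
  case (Fun f ps)
  then show ?case by (cases f) auto
qed simp

lemma inst_cong:
  "(\<And>z s. z \<in> vars p \<Longrightarrow> I z s = J z s) \<Longrightarrow> inst C ar I p s = inst C ar J p s"
proof (induction C ar I p s rule: inst.induct)
  case (4 C ar I f ps s)
  then show ?case by (auto intro!: ex_cong1) (metis UN_I nth_mem)+
qed auto

text \<open>\<open>A\<close> accepts exactly the ground terms, so abstracting a variable means
  allowing any ground term at each of its occurrences.\<close>

lemma inst_abstr:
  "inst C ar I (abstr V p) s = inst C ar (\<lambda>z. if z \<in> V then I z else ground C ar) p s"
  unfolding abstr_def inst_app by (rule inst_cong) auto

lemma oground_inst:
  "inst C ar I p s \<Longrightarrow> (\<And>z s. z \<in> vars p \<Longrightarrow> I z s \<Longrightarrow> ground C ar s) \<Longrightarrow> oground C ar s"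
proof (induction C ar I p s rule: inst.induct)
  case (4 C ar I f ps s)
  from 4(2) obtain ss where ss: "s = Some (Fun f ss)" "f \<in> C" "length ss = ar f" "length ps = ar f"
     "\<And>i. i < length ps \<Longrightarrow> inst C ar I (ps ! i) (Some (ss ! i))" by auto
  have "oground C ar (Some (ss ! i))" if i: "i < ar f" for i
  proof (rule 4(1))
    show "i < length ps" "inst C ar I (ps ! i) (Some (ss ! i))" using i ss by auto
    show "ground C ar s" if "z \<in> vars (ps ! i)" "I z s" for z s
      using that i ss(4) nth_mem[of i ps] by (intro 4(3)[of z s]) auto
  qed
  with ss show ?case by (auto simp: ground_Fun)
qed auto

text \<open>Applying one ground substitution is the special case in which all occurrences of a
  variable receive the same term.\<close>

lemma inst_emb_ground:
  assumes "t \<in> terms C ar UNIV" "\<And>x. x \<in> vars t \<Longrightarrow> \<xi> x \<in> terms C ar {}"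
  shows "inst C ar (\<lambda>_. ground C ar) (emb t) (Some (app \<xi> t))"
  using assms
proof (induction rule: terms.induct)
  case (2 f ts)
  have "inst C ar (\<lambda>_. ground C ar) (emb (ts ! i)) (Some (app \<xi> (ts ! i)))" if "i < length ts" for i
    using 2(3,4) nth_mem[OF that] by auto
  with 2(1,2) show ?case by auto
qed (auto simp: ground_def)

text \<open>The predicate \<open>ground C ar\<close> is the same for all variables, so their names
  are irrelevant. This absorbs the renaming apart in the semantics of \<open>Rec\<close>, whichever
  admissible renaming is chosen.\<close>

lemma inst_emb_renaming:
  assumes "renaming \<rho>"
  shows "inst C ar (\<lambda>_. ground C ar) (emb (app \<rho> t)) s = inst C ar (\<lambda>_. ground C ar) (emb t) s"
  unfolding emb_app app_ext_def inst_app
proof (rule inst_cong)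
  fix z s show "inst C ar (\<lambda>_. ground C ar) (emb (\<rho> z)) s = ground C ar s"
    using renaming_Var[OF assms, of z] by auto
qed

section \<open>Completeness of the pairing of patterns\<close>

lemma ext_trm_cases [case_names Var Con A Bot]:
  obtains x where "p = Var x" | f ps where "p = Fun (Con f) ps" | ps where "p = Fun A ps"
  | ps where "p = Fun Bot ps"
  by (metis ext.exhaust trm.exhaust)

text \<open>An \<open>A\<close> that stands for a term with \<open>n\<close> arguments is unfolded
  to \<open>n\<close> copies of \<open>A\<close>.\<close>

fun pargs :: "('f ext, 'v) trm \<Rightarrow> nat \<Rightarrow> ('f ext, 'v) trm list" where
  "pargs (Fun (Con f) ps) n = ps"
| "pargs (Fun A ps) n = replicate n A_t"
| "pargs _ n = []"

text \<open>The second argument is needed because the arity of an instance of \<open>A\<close> can only be read off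
  the instance.\<close>

definition parg :: "('f ext, 'v) trm \<Rightarrow> ('f, 'w) trm option \<Rightarrow> nat \<Rightarrow> ('f ext, 'v) trm" where
  "parg p s i = (if i < length (args s) then pargs p (length (args s)) ! i else Bot_t)"

lemma inst_parg:
  assumes "inst C ar I p s" "p \<notin> range Var"
  shows "inst C ar I (parg p s i) (arg s i)"
proof (cases p rule: ext_trm_cases)
  case (A ps)
  with assms(1) have "ps = []" "ground C ar s" by simp_all
  from this(2) obtain f ss where "s = Some (Fun f ss)" "length ss = ar f"
    "\<forall>i < ar f. ground C ar (Some (ss ! i))" by (rule groundE)
  with A \<open>ps = []\<close> show ?thesis by (simp add: parg_def arg_def)
qed (use assms in \<open>auto simp: parg_def arg_def\<close>)

text \<open>Padding by \<open>parg\<close> merges all rules of \<open>pairing\<close> that produce a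
  symbol into one; the constructor to guess for an \<open>A\<close> is the root of its instance. The
  excluded combinations of \<open>A\<close> and \<bottom> belong to the special
  non-terminals.\<close>

lemma pairing_Fun:
  assumes "inst C ar I p s" "inst C ar J q t" "p \<notin> range Var" "q \<notin> range Var"
    and "p \<notin> {A_t, Bot_t} \<or> q \<notin> {A_t, Bot_t}"
    and "length us = arity s t"
    and "\<And>i. i < arity s t \<Longrightarrow> pairing C ar P T (parg p s i) (parg q t i) (us ! i)"
  shows "pairing C ar P T p q (Fun (root s, root t) us)"
proof -
  let ?m = "length (args s)" and ?n = "length (args t)"
  have "pairing C ar P T (pargs p ?m ! i) (pargs q ?n ! i) (us ! i)" if "i < ?m" "i < ?n" for i
    using assms(7)[of i] that by (simp add: parg_def arity_def)
  moreover have "pairing C ar P T Bot_t (pargs q ?n ! i) (us ! i)" if "?m \<le> i" "i < ?n" for i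
    using assms(7)[of i] that by (simp add: parg_def arity_def)
  moreover have "pairing C ar P T (pargs p ?m ! i) Bot_t (us ! i)" if "?n \<le> i" "i < ?m" for i
    using assms(7)[of i] that by (simp add: parg_def arity_def)
  moreover note assms(1-6)
  ultimately show ?thesis
    by (cases p rule: ext_trm_cases; cases q rule: ext_trm_cases)
      (auto simp: arity_def dest!: ground_root intro!: pairing.intros)
qed


section \<open>Invariants of the parallel descent into two patterns\<close>

text \<open>This is the shape condition for terms already abstracted with respect to
  \<open>V\<close>, where a term without variables of \<open>V\<close> has no variables at
  all.\<close>

definition compat :: "'v set \<Rightarrow> ('f ext, 'v) trm \<Rightarrow> ('f ext, 'v) trm \<Rightarrow> bool" where
  "compat V p q \<longleftrightarrow> (\<forall>r \<in> poss p \<inter> poss q.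
     (subt_at p r \<in> Var ` V \<longrightarrow> subt_at q r \<in> Var ` V \<or> vars (subt_at q r) = {}) \<and>
     (subt_at q r \<in> Var ` V \<longrightarrow> subt_at p r \<in> Var ` V \<or> vars (subt_at p r) = {}))"

text \<open>A variable-free term that meets a variable must be a pattern or \<bottom> to serve as an
  index of \<open>Gam\<close>. The condition covers all subterms so that it survives the
  descent.\<close>

definition closed_in :: "('f ext, 'v) trm set \<Rightarrow> ('f ext, 'v) trm \<Rightarrow> bool" where
  "closed_in P p \<longleftrightarrow> (\<forall>r \<in> subterms p. vars r = {} \<longrightarrow> r \<in> insert Bot_t P)"

text \<open>At least one side is a variable, as in every rule of \<open>pairing\<close> that yields
  a \<open>Gam\<close>.\<close>

definition indexed :: "'v set \<Rightarrow> ('f ext, 'v) trm set \<Rightarrow> ('f ext, 'v) trm \<Rightarrow> ('f ext, 'v) trm \<Rightarrow> bool" where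
  "indexed V P p q \<longleftrightarrow> p \<in> Var ` V \<and> q \<in> Var ` V \<union> insert Bot_t P \<or>
     q \<in> Var ` V \<and> p \<in> Var ` V \<union> insert Bot_t P"

definition special :: "'a option \<Rightarrow> 'b option \<Rightarrow> ('f, 'v) rnt" where
  "special s t = (if s = None then BotA else if t = None then ABot else AA)"

lemma compat_sym: "compat V p q \<Longrightarrow> compat V q p"
  by (auto simp: compat_def)

text \<open>A variable-free side never shows a variable of \<open>V\<close> and always meets the
  second alternative. This handles patterns and \<bottom>.\<close>

lemma compat_ground:
  assumes "vars p = {}" shows "compat V p q"
  unfolding compat_def
proof (intro ballI conjI impI)
  fix r assume "r \<in> poss p \<inter> poss q"
  then have *: "vars (subt_at p r) = {}" using vars_subt_at[of r p] assms by blast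
  then show "subt_at p r \<in> Var ` V \<or> vars (subt_at p r) = {}" ..
  assume "subt_at p r \<in> Var ` V"
  with * show "subt_at q r \<in> Var ` V \<or> vars (subt_at q r) = {}" by auto
qed

lemma compat_nth:
  assumes "compat V (Fun f ps) (Fun g qs)" "i < length ps" "i < length qs"
  shows "compat V (ps ! i) (qs ! i)"
  unfolding compat_def
proof
  fix r assume "r \<in> poss (ps ! i) \<inter> poss (qs ! i)"
  with assms(2,3) have "i # r \<in> poss (Fun f ps) \<inter> poss (Fun g qs)" by auto
  from bspec[OF assms(1)[unfolded compat_def] this]
  show "(subt_at (ps ! i) r \<in> Var ` V \<longrightarrow> subt_at (qs ! i) r \<in> Var ` V \<or> vars (subt_at (qs ! i) r) = {}) \<and>
     (subt_at (qs ! i) r \<in> Var ` V \<longrightarrow> subt_at (ps ! i) r \<in> Var ` V \<or> vars (subt_at (ps ! i) r) = {})"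
    by simp
qed

lemma parg_cases:
  assumes "inst C ar I p s" "p \<notin> range Var"
  obtains f ps where "p = Fun (Con f) ps" "i < length ps" "parg p s i = ps ! i"
  | "p = A_t" "parg p s i = A_t" | "parg p s i = Bot_t"
proof -
  have "(\<exists>f ps. p = Fun (Con f) ps \<and> i < length ps \<and> parg p s i = ps ! i) \<or>
      p = A_t \<and> parg p s i = A_t \<or> parg p s i = Bot_t"
    using assms by (cases p rule: ext_trm_cases) (auto simp: parg_def)
  with that show thesis by blast
qed

lemma compat_parg:
  assumes "inst C ar I p s" "p \<notin> range Var" "inst C ar J q t" "q \<notin> range Var" "compat V p q"
  shows "compat V (parg p s i) (parg q t i)"
  using assms(5)
  by (cases rule: parg_cases[OF assms(1,2), of i]; cases rule: parg_cases[OF assms(3,4), of i])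
    (auto intro: compat_nth compat_ground compat_sym[OF compat_ground])

lemma closed_in_parg:
  assumes "inst C ar I p s" "p \<notin> range Var" "closed_in P p"
  shows "closed_in P (parg p s i)"
  using assms(3) by (cases rule: parg_cases[OF assms(1,2), of i])
    (auto simp: closed_in_def subterms_nth, auto simp: subterms_def)

lemma vars_parg:
  assumes "inst C ar I p s" "p \<notin> range Var"
  shows "vars (parg p s i) \<subseteq> vars p"
  by (cases rule: parg_cases[OF assms, of i]) (auto, metis nth_mem)

section \<open>Derivations that follow the code of a pair\<close>

text \<open>A ground term with root \<open>f\<close> is an instance of \<open>f(A, ..., A)\<close>,
  and the arguments of two such patterns pair to special non-terminals again, so the derivation can
  follow the code downwards.\<close>

lemma special_complete:
  fixes R :: "('f ext \<times> 'f ext, ('f, 'v) rnt) rtg" and s :: "('f, 'w) trm option"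
    and t :: "('f, 'w) trm option"
  assumes AA: "\<And>f g u. f \<in> C \<Longrightarrow> g \<in> C \<Longrightarrow> pairing C ar P T (Fun (Con f) (replicate (ar f) A_t))
      (Fun (Con g) (replicate (ar g) A_t)) u \<Longrightarrow> (AA, u) \<in> rules R"
    and ABot: "\<And>f u. f \<in> C \<Longrightarrow> pairing C ar P T (Fun (Con f) (replicate (ar f) A_t)) Bot_t u \<Longrightarrow>
      (ABot, u) \<in> rules R"
    and BotA: "\<And>g u. g \<in> C \<Longrightarrow> pairing C ar P T Bot_t (Fun (Con g) (replicate (ar g) A_t)) u \<Longrightarrow>
      (BotA, u) \<in> rules R"
    and s: "oground C ar s" and t: "oground C ar t" and st: "s \<noteq> None \<or> t \<noteq> None"
  shows "(step R)\<^sup>*\<^sup>* (Var (special s t)) (ocode s t)"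
  using s t st
proof (induction rule: ocode_induct)
  case (step s t)
  define pat :: "('f, 'w) trm option \<Rightarrow> ('f ext, 'v) trm" where
    "pat r = (case root r of Con f \<Rightarrow> Fun (Con f) (replicate (ar f) A_t) | _ \<Rightarrow> Bot_t)" for r
  \<comment> \<open>The patterns \<open>pat r\<close> contain no variables, so any predicate for
    variables will do.\<close>
  have "inst C ar (\<lambda>_ _. False) (pat r) r \<and> pat r \<notin> range Var \<and>
      (\<forall>i. parg (pat r) r i = (if arg r i = None then Bot_t else A_t))" if "oground C ar r" for r
  proof (cases "r = None")
    case False
    with that obtain f ss where "r = Some (Fun f ss)" "f \<in> C" "length ss = ar f"
      "\<forall>i < ar f. ground C ar (Some (ss ! i))" by (auto elim: groundE)
    then show ?thesis by (simp add: pat_def parg_def arg_def image_iff)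
  qed (simp add: pat_def parg_def arg_def image_iff)
  then have pat: "inst C ar (\<lambda>_ _. False) (pat r) r" "pat r \<notin> range Var"
    "parg (pat r) r i = (if arg r i = None then Bot_t else A_t)" if "oground C ar r" for r i
    using that by blast+
  have pat_root: "r = None \<and> pat r = Bot_t \<or>
      (\<exists>f \<in> C. r \<noteq> None \<and> pat r = Fun (Con f) (replicate (ar f) A_t))" if "oground C ar r" for r
    using that by (auto simp: pat_def dest: ground_root)
  let ?us = "map (\<lambda>i. Var (special (arg s i) (arg t i))) [0..<arity s t]"
  have "pairing C ar P T (pat s) (pat t) (Fun (root s, root t) ?us)"
  proof (rule pairing_Fun[OF pat(1)[OF step(1)] pat(1)[OF step(2)] pat(2)[OF step(1)] pat(2)[OF step(2)]])
    show "pat s \<notin> {A_t, Bot_t} \<or> pat t \<notin> {A_t, Bot_t}"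
      using step(3) pat_root[OF step(1)] pat_root[OF step(2)] by auto
    show "pairing C ar P T (parg (pat s) s i) (parg (pat t) t i) (?us ! i)" if "i < arity s t" for i
      using that arg_not_None[OF that]
      by (auto simp: pat(3)[OF step(1)] pat(3)[OF step(2)] special_def intro: pairing.intros)
  qed simp
  then have "(special s t, Fun (root s, root t) ?us) \<in> rules R"
    using step(3) pat_root[OF step(1)] pat_root[OF step(2)]
    by (auto simp: special_def intro: AA ABot BotA)
  then have "step R (Var (special s t)) (Fun (root s, root t) ?us)" by (rule step.intros)
  also have "(step R)\<^sup>*\<^sup>* (Fun (root s, root t) ?us) (ocode s t)"
    unfolding ocode_unfold[OF step(1-3)] by (rule steps_Fun) (use step(4) in auto)
  finally show ?case .
qed

text \<open>The descent along \<open>s\<close> and \<open>t\<close> stops where one side is a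
  variable, and there \<open>indexed\<close> takes over, or where both sides are \<open>A\<close> or
  \<bottom>, and there \<open>special\<close> does. In the main induction \<open>indexed\<close> is
  the induction hypothesis for the called goal clause.\<close>

lemma pairing_complete:
  fixes s t :: "('f, 'v) trm option"
  assumes special: "\<And>s t :: ('f, 'v) trm option. oground C ar s \<Longrightarrow> oground C ar t \<Longrightarrow>
      s \<noteq> None \<or> t \<noteq> None \<Longrightarrow> (step R)\<^sup>*\<^sup>* (Var (special s t)) (ocode s t)"
    and indexed: "\<And>p q s t. indexed V P p q \<Longrightarrow> inst C ar I p s \<Longrightarrow> inst C ar I q t \<Longrightarrow>
      (step R)\<^sup>*\<^sup>* (Var (Gam T p q)) (ocode s t)"
    and I: "\<And>z s. z \<in> V \<Longrightarrow> I z s \<Longrightarrow> ground C ar s"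
    and p: "inst C ar I p s" "vars p \<subseteq> V" "closed_in P p"
    and q: "inst C ar I q t" "vars q \<subseteq> V" "closed_in P q"
    and pq: "compat V p q" "s \<noteq> None \<or> t \<noteq> None"
  shows "\<exists>u. pairing C ar P T p q u \<and> (step R)\<^sup>*\<^sup>* u (ocode s t)"
proof -
  have og: "oground C ar s" if "inst C ar I p s" "vars p \<subseteq> V" for p s
    using oground_inst[OF that(1)] I that(2) by blast
  from og[OF p(1,2)] og[OF q(1,2)] pq(2) p q pq(1) show ?thesis
  proof (induction s t arbitrary: p q rule: ocode_induct)
    case (step s t p q)
    show ?case
    proof (cases "p \<in> range Var \<or> q \<in> range Var")
      case True
      have *: "r \<in> insert Bot_t P" if "closed_in P r" "vars r = {}" for r
        using that subterms_refl unfolding closed_in_def by blast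
      \<comment> \<open>Compatibility at the root position suffices: opposite a variable stands a
        variable or a variable-free term, and \<open>closed_in\<close> makes the latter a pattern or
        \<bottom>.\<close>
      have "[] \<in> poss p" "[] \<in> poss q" by (cases p; auto) (cases q; auto)
      then have "(p \<in> Var ` V \<longrightarrow> q \<in> Var ` V \<or> vars q = {}) \<and> (q \<in> Var ` V \<longrightarrow> p \<in> Var ` V \<or> vars p = {})"
        using step(11) unfolding compat_def by (metis IntI subt_at.simps(1))
      then have "indexed V P p q"
        using True step(6,9) *[OF step(7)] *[OF step(10)] unfolding indexed_def by auto
      moreover from this have "pairing C ar P T p q (Var (Gam T p q))"
        unfolding indexed_def by (auto intro: pairing.intros)
      ultimately show ?thesis using indexed step(5,8) by blast
    next
      case False
      then have nv: "p \<notin> range Var" "q \<notin> range Var" by auto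
      show ?thesis
      proof (cases "p \<in> {A_t, Bot_t} \<and> q \<in> {A_t, Bot_t}")
        case True
        \<comment> \<open>Two occurrences of \<bottom> are impossible since \<open>s\<close> and
          \<open>t\<close> are not both absent; an instance of \<open>A\<close> is never absent, so
          \<open>special\<close> names the right non-terminal.\<close>
        then have "pairing C ar P T p q (Var (special s t))"
          using step(3,5,8) by (auto simp: special_def ground_def intro: pairing.intros)
        with special[OF step(1-3)] show ?thesis by blast
      next
        case False
        have "\<exists>u. pairing C ar P T (parg p s i) (parg q t i) u \<and>
            (step R)\<^sup>*\<^sup>* u (ocode (arg s i) (arg t i))" if "i < arity s t" for i
          using vars_parg[OF step(5) nv(1), of i] vars_parg[OF step(8) nv(2), of i] step(6,9)
          by (intro step(4)[OF that] inst_parg[OF step(5) nv(1)] inst_parg[OF step(8) nv(2)]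
              closed_in_parg[OF step(5) nv(1) step(7)] closed_in_parg[OF step(8) nv(2) step(10)]
              compat_parg[OF step(5) nv(1) step(8) nv(2) step(11)]) auto
        then obtain u where u: "\<And>i. i < arity s t \<Longrightarrow> pairing C ar P T (parg p s i) (parg q t i) (u i)"
            "\<And>i. i < arity s t \<Longrightarrow> (step R)\<^sup>*\<^sup>* (u i) (ocode (arg s i) (arg t i))" by metis
        let ?us = "map u [0..<arity s t]"
        have "pairing C ar P T p q (Fun (root s, root t) ?us)"
          by (rule pairing_Fun[OF step(5,8) nv]) (use False u(1) in auto)
        moreover have "(step R)\<^sup>*\<^sup>* (Fun (root s, root t) ?us) (ocode s t)"
          unfolding ocode_unfold[OF step(1-3)] by (rule steps_Fun) (use u(2) in auto)
        ultimately show ?thesis by blast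
      qed
    qed
  qed
qed

section \<open>The range grammar\<close>

lemma app_ground: "vars t = {} \<Longrightarrow> app \<sigma> t = t"
  using app_cong[of t \<sigma> Var] by simp

lemma app_ext_ground: "vars t = {} \<Longrightarrow> app_ext \<theta> t = t"
  unfolding app_ext_def by (rule app_ground)

lemma abstr_ground_id: "vars t = {} \<Longrightarrow> abstr V t = t"
  unfolding abstr_def by (rule app_ground)

lemma poss_Var_valued:
  assumes "\<And>v. \<exists>w. \<delta> v = Var w"
  shows "poss (app \<delta> t) = poss t"
    and "q \<in> poss t \<Longrightarrow> subt_at (app \<delta> t) q = app \<delta> (subt_at t q)"
proof -
  have "poss (\<delta> v) = {[]}" for v using assms[of v] by auto
  then show "poss (app \<delta> t) = poss t"
    and "q \<in> poss t \<Longrightarrow> subt_at (app \<delta> t) q = app \<delta> (subt_at t q)"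
    by (rule poss_subt_at_app)+
qed

text \<open>Patterns come from \<theta>, right-hand sides from \<delta>\<theta>; the renaming
  \<delta> disappears once every variable becomes \<open>A\<close>.\<close>

lemma abstr_empty_app_Var_valued:
  assumes "\<And>v. \<exists>w. \<delta> v = Var w"
  shows "abstr {} (emb (app \<delta> t)) = abstr {} (emb t)"
  unfolding emb_app app_ext_def abstr_def app_app
proof (rule app_cong)
  fix x
  show "app (\<lambda>x. if x \<in> {} then Var x else A_t) (emb (\<delta> x)) = (if x \<in> {} then Var x else A_t)"
    using assms[of x] by auto
qed

text \<open>A variable-free subterm of the abstracted \<delta>\<theta>(x) stems from a subterm of
  \<theta>(x), hence is a pattern. \<open>Sub \<theta>\<close> is required to occur only if \<theta>
  moves a variable: in a bare \<open>Rec\<close> right-hand side, \<theta> is the identity and is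
  not written.\<close>

lemma closed_in_Pat:
  assumes "\<And>v. \<exists>w. \<delta> v = Var w" "(n, \<beta>) \<in> rules G" "\<And>x. x \<in> sdom \<theta> \<Longrightarrow> Sub \<theta> \<in> funs \<beta>"
    and "p \<in> Var ` sdom \<theta> \<union> insert Bot_t (Pat G)"
  shows "closed_in (Pat G) (abstr V (app_ext (comp \<delta> \<theta>) p))"
  unfolding closed_in_def
proof (intro ballI impI)
  fix r assume r: "r \<in> subterms (abstr V (app_ext (comp \<delta> \<theta>) p))" "vars r = {}"
  consider x where "p = Var x" "x \<in> sdom \<theta>" | "p = Bot_t" | "p \<in> Pat G" using assms(4) by blast
  then show "r \<in> insert Bot_t (Pat G)"
  proof cases
    case 1
    then have "r \<in> subterms (abstr V (emb (app \<delta> (\<theta> x))))"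
      using r(1) by (simp add: app_ext_def comp_def)
    then obtain q where q: "q \<in> poss (\<theta> x)" "r = abstr V (emb (app \<delta> (subt_at (\<theta> x) q)))"
      by (auto simp: subterms_def subt_at_abstr subt_at_emb poss_Var_valued[of \<delta>, OF assms(1)])
    with r(2) have "r = abstr {} (emb (subt_at (\<theta> x) q))"
      using abstr_ground[of V "emb (app \<delta> (subt_at (\<theta> x) q))"]
        abstr_empty_app_Var_valued[of \<delta> "subt_at (\<theta> x) q", OF assms(1)] by simp
    moreover have "\<theta> x \<in> sran \<theta>" "subt_at (\<theta> x) q \<in> subterms (\<theta> x)"
      using 1(2) q(1) by (auto simp: sran_def subterms_def)
    ultimately have "r \<in> Pat G" using assms(2) assms(3)[OF 1(2)] unfolding Pat_def by blast
    then show ?thesis by simp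
  next
    case 2
    with r(1) show ?thesis by (simp add: app_ext_def abstr_def subterms_def)
  next
    case 3
    with r(1) show ?thesis using Pat_subterm[OF 3] by (simp add: app_ext_ground abstr_ground_id vars_Pat)
  qed
qed

lemma abstr_emb_Var: "abstr V (emb t) \<in> Var ` V \<longleftrightarrow> t \<in> Var ` V"
  by (cases t) (auto simp: abstr_def)

text \<open>A pattern or \<bottom> on one side is settled by \<open>compat_ground\<close>; for two
  variables of \<open>T'\<close> the shape assumption is used in both orders.\<close>

lemma compat_comp:
  assumes "compatible C ar T' T'' \<delta> \<theta>" "indexed (gvars T') (Pat G) p q"
  shows "compat (gvars T'') (abstr (gvars T'') (app_ext (comp \<delta> \<theta>) p))
    (abstr (gvars T'') (app_ext (comp \<delta> \<theta>) q))"
proof -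
  let ?a = "\<lambda>p. abstr (gvars T'') (app_ext (comp \<delta> \<theta>) p)"
  have gr: "vars (?a p) = {}" if "p \<in> insert Bot_t (Pat G)" for p
    using that by (auto simp: app_ext_ground abstr_ground_id vars_Pat)
  consider "p \<in> insert Bot_t (Pat G)" | "q \<in> insert Bot_t (Pat G)"
    | x y where "p = Var x" "q = Var y" "x \<in> gvars T'" "y \<in> gvars T'"
    using assms(2) unfolding indexed_def by auto
  then show ?thesis
  proof cases
    case (3 x y)
    have *: "r \<in> poss (comp \<delta> \<theta> x) \<inter> poss (comp \<delta> \<theta> y) \<Longrightarrow>
        subt_at (abstr (gvars T'') (emb (comp \<delta> \<theta> x))) r \<in> Var ` gvars T'' \<Longrightarrow>
        subt_at (abstr (gvars T'') (emb (comp \<delta> \<theta> y))) r \<in> Var ` gvars T'' \<or>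
        vars (subt_at (abstr (gvars T'') (emb (comp \<delta> \<theta> y))) r) = {}"
      if "x \<in> gvars T'" "y \<in> gvars T'" for x y r
    proof -
      assume r: "r \<in> poss (comp \<delta> \<theta> x) \<inter> poss (comp \<delta> \<theta> y)"
        "subt_at (abstr (gvars T'') (emb (comp \<delta> \<theta> x))) r \<in> Var ` gvars T''"
      then have "subt_at (comp \<delta> \<theta> x) r \<in> Var ` gvars T''"
        by (simp add: subt_at_abstr subt_at_emb abstr_emb_Var)
      then have "subt_at (comp \<delta> \<theta> y) r \<in> Var ` gvars T'' \<union> terms C ar (- gvars T'')"
        using assms(1) that r(1) unfolding compatible_def by blast
      then show ?thesis using r(1)
        by (auto simp: subt_at_abstr subt_at_emb abstr_emb_Var vars_abstr dest!: terms_vars)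
    qed
    show ?thesis
      using *[OF 3(3,4)] *[OF 3(4,3)] 3(1,2) by (auto simp: compat_def app_ext_def)
  qed (use gr in \<open>auto intro: compat_ground compat_sym[OF compat_ground]\<close>)
qed

section \<open>Expressions generated by a substitution-set grammar and their values\<close>

text \<open>Inverts the first derivation step and the semantics together. The smaller
  \<open>e'\<close> carries the later inductions; \<xi> is the renaming apart chosen by the
  semantics. The set \<open>insert Var S\<close> allows for the identity of a bare
  \<open>Rec\<close>, which need not lie in \<open>S\<close>.\<close>

lemma lang_cases:
  assumes G: "ssg C ar S G" "shape_assumption C ar G T" "reachable G T T'"
    and e: "e \<in> lang G T'" "sem S e \<sigma>"
  obtains (Sub) "(T', sub_e \<sigma>) \<in> rules G" "sdom \<sigma> = gvars T'" "\<sigma> \<in> S"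
  | (Rec) \<beta> T'' \<delta> \<theta> e' \<sigma>' \<xi> where "(T', \<beta>) \<in> rules G" "rec_rhs \<beta> T'' \<delta> \<theta>" "sdom \<theta> = gvars T'"
      "vran \<delta> = gvars T''" "compatible C ar T' T'' \<delta> \<theta>" "renaming \<delta>" "renaming \<xi>" "\<delta> \<in> S" "\<theta> \<in> insert Var S"
      "T'' \<in> nts G" "reachable G T T''" "e' \<in> lang G T''" "size e' < size e" "sem S e' \<sigma>'"
      "gvars T'' \<subseteq> sdom \<sigma>'"
      "\<sigma> = comp (restr (comp (restr (comp \<xi> \<sigma>') (sdom \<sigma>')) \<delta>) (sdom \<delta>)) \<theta>"
proof -
  from e(1) obtain \<beta> where \<beta>: "(T', \<beta>) \<in> rules G" "(step G)\<^sup>*\<^sup>* \<beta> e" "vars e = {}" by (rule langE)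
  have rhs: "ssg_rhs S (nts G) \<beta>" "vars \<beta> \<subseteq> nts G"
    using G(1) \<beta>(1) by (auto simp: ssg_def wf_rtg_def)
  have sub: "t = sub_e \<theta>" if "(step G)\<^sup>*\<^sup>* (sub_e \<theta>) t" for \<theta> t
    using that by (rule steps_FunE) simp
  \<comment> \<open>Common core of both recursive forms; \<tau> is the value of the
    \<open>Rec\<close> part, and \<theta> is the identity if nothing is composed with it.\<close>
  have rec: thesis if r: "rec_rhs \<beta> T'' \<delta> \<theta>" "sdom \<theta> = gvars T'" "vran \<delta> = gvars T''"
    "compatible C ar T' T'' \<delta> \<theta>" "renaming \<delta>" "\<delta> \<in> S" "\<theta> \<in> insert Var S"
    and e': "(step G)\<^sup>*\<^sup>* (Var T'') e'" "vars e' = {}" "size e' < size e"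
    and sm: "sem S (rec_e e' \<delta>) \<tau>" "\<sigma> = comp \<tau> \<theta>" for T'' \<delta> \<theta> e' \<tau>
  proof -
    have T'': "T'' \<in> vars \<beta>" using r(1) by (auto simp: rec_rhs_def)
    from G(3) \<beta>(1) T'' have "reachable G T T''"
      unfolding reachable_def by (auto intro: rtranclp.rtrancl_into_rtrancl)
    moreover from sm(1) obtain \<sigma>' \<sigma>'' where "sem S e' \<sigma>'" "vran \<delta> \<subseteq> sdom \<sigma>'"
      "renamed_apart S \<sigma>' \<delta> \<sigma>''" "\<tau> = restr (comp \<sigma>'' \<delta>) (sdom \<delta>)"
      by cases auto
    ultimately show thesis
      using Rec[OF \<beta>(1) r(1-5) _ r(6,7) subsetD[OF rhs(2) T''] _ _ e'(3)] r(3) e'(1,2) sm(2)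
      unfolding renamed_apart_def lang_def by blast
  qed
  from G(2,3) \<beta>(1) consider (s) \<theta> where "\<beta> = sub_e \<theta>" "sdom \<theta> = gvars T'"
    | (r) T'' \<delta> \<theta> where "rec_rhs \<beta> T'' \<delta> \<theta>" "sdom \<theta> = gvars T'" "vran \<delta> = gvars T''"
      "compatible C ar T' T'' \<delta> \<theta>"
    unfolding shape_assumption_def by metis
  then show thesis
  proof cases
    case s
    with \<beta>(2) sub have "e = sub_e \<theta>" by blast
    with e(2) have "\<sigma> = \<theta>" by (auto elim: sem.cases)
    moreover from rhs(1) s(1) have "\<theta> \<in> S" by (auto elim: ssg_rhs.cases)
    ultimately show thesis using Sub \<beta>(1) s by blast
  next
    case r
    have \<delta>: "renaming \<delta>" "\<delta> \<in> S" if "ssg_rhs S (nts G) (rec_e (Var T'') \<delta>)"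
      using that by (auto elim: ssg_rhs.cases)
    have rece: "\<exists>e'. t = rec_e e' \<delta> \<and> (step G)\<^sup>*\<^sup>* (Var T'') e'"
      if "(step G)\<^sup>*\<^sup>* (rec_e (Var T'') \<delta>) t" for t
      using that by (rule steps_FunE) (auto simp: list_all2_Cons1 dest: sub)
    from r(1) consider (c) "\<beta> = comp_e (rec_e (Var T'') \<delta>) (sub_e \<theta>)"
      | (v) "\<beta> = rec_e (Var T'') \<delta>" "\<theta> = Var"
      unfolding rec_rhs_def by blast
    then show thesis
    proof cases
      case c
      from rhs(1)[unfolded c] have "ssg_rhs S (nts G) (rec_e (Var T'') \<delta>)" "ssg_rhs S (nts G) (sub_e \<theta>)"
        by (auto elim: ssg_rhs.cases)
      moreover from this(2) have "\<theta> \<in> S" by (auto elim: ssg_rhs.cases)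
      moreover from \<beta>(2)[unfolded c] obtain e0 where "e = comp_e e0 (sub_e \<theta>)"
        "(step G)\<^sup>*\<^sup>* (rec_e (Var T'') \<delta>) e0"
        by (rule steps_FunE) (auto simp: list_all2_Cons1 dest: sub)
      moreover from rece[OF this(2)] obtain e' where "e0 = rec_e e' \<delta>" "(step G)\<^sup>*\<^sup>* (Var T'') e'" by blast
      moreover from e(2)[unfolded \<open>e = _\<close>] obtain \<tau> \<theta>'
        where "sem S e0 \<tau>" "sem S (sub_e \<theta> :: (_, _, ('a, 'b) goal) sexp) \<theta>'" "\<sigma> = comp \<tau> \<theta>'"
        by cases auto
      moreover from this(2) have "\<theta>' = \<theta>" by cases auto
      ultimately show thesis using \<beta>(3) by (intro rec[OF r \<delta>, of e' \<tau>]) auto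
    next
      case v
      from rece \<beta>(2)[unfolded v(1)] obtain e' where "e = rec_e e' \<delta>" "(step G)\<^sup>*\<^sup>* (Var T'') e'" by blast
      then show thesis using \<beta>(3) e(2) rhs(1) v by (intro rec[OF r \<delta>, of e' \<sigma>]) (auto simp: comp_def)
    qed
  qed
qed

lemma Var_in_terms [simp]: "Var x \<in> terms C ar V \<longleftrightarrow> x \<in> V"
  by (auto intro: terms.intros(1) dest: terms_vars)

lemma app_in_terms:
  "t \<in> terms C ar V \<Longrightarrow> (\<And>x. x \<in> V \<Longrightarrow> \<sigma> x \<in> terms C ar W) \<Longrightarrow> app \<sigma> t \<in> terms C ar W"
  by (induction rule: terms.induct) (auto intro!: terms.intros(2))

lemma substs_in_terms: "\<sigma> \<in> substs C ar \<Longrightarrow> \<sigma> x \<in> terms C ar UNIV"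
  by (cases "x \<in> sdom \<sigma>") (auto simp: substs_def sran_def sdom_def)

text \<open>Renamings add only variables and all other parts come from \<open>S\<close>. This is
  what makes the terms \<xi>\<theta>(x) of the theorem ground constructor terms.\<close>

lemma Substs_in_terms:
  assumes "ssg C ar S G" "shape_assumption C ar G T" "reachable G T T'" "e \<in> lang G T'" "sem S e \<sigma>"
  shows "\<sigma> x \<in> terms C ar UNIV"
  using assms(3-5)
proof (induction "size e" arbitrary: T' e \<sigma> x rule: less_induct)
  case less
  have S: "\<theta> x \<in> terms C ar UNIV" if "\<theta> \<in> insert Var S" for \<theta> x
    using that assms(1) by (auto simp: ssg_def intro: substs_in_terms)
  from assms(1,2) less.prems show ?case
  proof (cases rule: lang_cases)
    case Sub
    then show ?thesis using S by blast
  next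
    case (Rec \<beta> T'' \<delta> \<theta> e' \<sigma>' \<xi>)
    have IH: "\<sigma>' x \<in> terms C ar UNIV" for x by (rule less.hyps[OF Rec(13,11,12,14)])
    have "\<xi> x \<in> terms C ar UNIV" for x
      using renaming_Var[OF Rec(7), of x] by auto
    then show ?thesis unfolding Rec(16)
      using IH S Rec(8,9) by (auto simp: comp_def restr_def intro!: app_in_terms[where V = UNIV])
  qed
qed

text \<open>A variable introduced by \<theta> either lies in \<open>sdom \<delta>\<close>, is sent
  into \<open>vran \<delta>\<close> and gets its value from \<sigma>' up to \<xi>, or it stays free.
  By disjointness of \<open>vran \<theta>\<close> and \<open>vran \<delta>\<close> a free one is not
  taken for a variable of the called clause but becomes \<open>A\<close>.\<close>

lemma inst_comp:
  assumes "renaming \<delta>" "renaming \<xi>" "vran \<delta> \<subseteq> sdom \<sigma>'" "vran \<theta> \<inter> vran \<delta> = {}" "vars p \<subseteq> sdom \<theta>"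
  shows "inst C ar (\<lambda>_. ground C ar)
      (app_ext (comp (restr (comp (restr (comp \<xi> \<sigma>') (sdom \<sigma>')) \<delta>) (sdom \<delta>)) \<theta>) p) s =
    inst C ar (\<lambda>z. inst C ar (\<lambda>_. ground C ar) (emb (\<sigma>' z)))
      (abstr (vran \<delta>) (app_ext (comp \<delta> \<theta>) p)) s"
  unfolding inst_abstr unfolding app_ext_def inst_app comp_def[of _ \<theta>] emb_app
proof (rule inst_cong, rule inst_cong)
  fix z s v r assume z: "z \<in> vars p" "v \<in> vars (emb (\<theta> z))"
  let ?\<tau> = "restr (comp (restr (comp \<xi> \<sigma>') (sdom \<sigma>')) \<delta>) (sdom \<delta>)"
  show "inst C ar (\<lambda>_. ground C ar) (emb (?\<tau> v)) r =
    inst C ar (\<lambda>z. if z \<in> vran \<delta> then inst C ar (\<lambda>_. ground C ar) (emb (\<sigma>' z)) else ground C ar) (emb (\<delta> v)) r"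
  proof (cases "v \<in> sdom \<delta>")
    case True
    obtain w where w: "\<delta> v = Var w" using renaming_Var[OF assms(1)] by blast
    with True have "w \<in> vran \<delta>" by (force simp: vran_def)
    with w True assms(3) show ?thesis
      by (auto simp: restr_def comp_def inst_emb_renaming[OF assms(2)])
  next
    case False
    have "v \<in> vran \<theta>" using z assms(5) by (auto simp: vran_def)
    with False assms(4) show ?thesis by (auto simp: restr_def sdom_def)
  qed
qed

text \<open>\<open>x1\<close> and \<open>x2\<close> affect only the start symbol, so the grammar is
  fixed while \<open>T'\<close>, \<open>p\<close> and \<open>q\<close> vary in the
  induction.\<close>

lemma Ran_complete:
  fixes s t :: "('f, 'v) trm option" and G :: "('f, 'v) grammar"
  assumes G: "ssg C ar S G" "shape_assumption C ar G T" "fresh_ranges G T"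
    and T': "reachable G T T'" "T' \<in> nts G" "e \<in> lang G T'" "sem S e \<sigma>"
    and pq: "indexed (gvars T') (Pat G) p q" "inst C ar (\<lambda>_. ground C ar) (app_ext \<sigma> p) s"
      "inst C ar (\<lambda>_. ground C ar) (app_ext \<sigma> q) t"
  shows "(step (Ran C ar G T x1 x2))\<^sup>*\<^sup>* (Var (Gam T' p q)) (ocode s t)"
  using T' pq
proof (induction "size e" arbitrary: T' e \<sigma> p q s t rule: less_induct)
  case less
  let ?R = "Ran C ar G T x1 x2" and ?I = "\<lambda>_. ground C ar"
  have special: "(step ?R)\<^sup>*\<^sup>* (Var (special s t)) (ocode s t)"
    if "oground C ar s" "oground C ar t" "s \<noteq> None \<or> t \<noteq> None" for s t :: "('f, 'v) trm option"
    by (rule special_complete[where P = "Pat G" and T = Top, OF _ _ _ that]) (auto simp: Ran_def)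
  have nt: "Gam T' p q \<in> Ran_nts G"
    using less.prems(2,5) unfolding indexed_def Ran_nts_def Vars_def by auto
  have mem: "p \<in> Var ` gvars T' \<union> insert Bot_t (Pat G)" "q \<in> Var ` gvars T' \<union> insert Bot_t (Pat G)"
    using less.prems(5) unfolding indexed_def by auto
  then have vars: "vars p \<subseteq> gvars T'" "vars q \<subseteq> gvars T'" by (auto dest: vars_Pat)
  \<comment> \<open>One of \<open>p\<close> and \<open>q\<close> is a variable, and the instances of
    its value under \<sigma> are never \<bottom>.\<close>
  have "s \<noteq> None \<or> t \<noteq> None"
  proof -
    have "r \<noteq> None" if "x \<in> gvars T'" "inst C ar ?I (app_ext \<sigma> (Var x)) r" for x r
      using that(2) by (cases "\<sigma> x") (auto simp: app_ext_def ground_def)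
    then show ?thesis using less.prems(5-7) unfolding indexed_def by blast
  qed
  from G(1,2) less.prems(1,3,4) show ?case
  proof (cases rule: lang_cases)
    case Sub
    \<comment> \<open>A rule without \<open>Rec\<close> is treated with the identity as \<delta> and
      the empty set as \<open>V\<close>: all variables become \<open>A\<close> and
      \<open>indexed\<close> cannot hold.\<close>
    have *: "closed_in (Pat G) (abstr {} (app_ext \<sigma> p))" if "p \<in> Var ` gvars T' \<union> insert Bot_t (Pat G)" for p
      using closed_in_Pat[OF _ Sub(1), of Var \<sigma> p "{}"] that Sub(2) by (simp add: comp_def)
    have "\<exists>u. pairing C ar (Pat G) Top (abstr {} (app_ext \<sigma> p)) (abstr {} (app_ext \<sigma> q)) u \<and>
        (step ?R)\<^sup>*\<^sup>* u (ocode s t)"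
      by (rule pairing_complete[where V = "{}" and I = ?I])
        (use special less.prems(6,7) *[OF mem(1)] *[OF mem(2)] \<open>s \<noteq> None \<or> t \<noteq> None\<close> in
          \<open>auto simp: indexed_def inst_abstr vars_abstr intro: compat_ground\<close>)
    then obtain u where u: "pairing C ar (Pat G) Top (abstr {} (app_ext \<sigma> p)) (abstr {} (app_ext \<sigma> q)) u"
        "(step ?R)\<^sup>*\<^sup>* u (ocode s t)" by blast
    have "(Gam T' p q, u) \<in> rules ?R" unfolding Ran_def using nt Sub(1) u(1) by auto
    then have "step ?R (Var (Gam T' p q)) u" by (rule step.intros)
    with u(2) show ?thesis by (rule converse_rtranclp_into_rtranclp[rotated])
  next
    case (Rec \<beta> T'' \<delta> \<theta> e' \<sigma>' \<xi>)
    let ?J = "\<lambda>z. inst C ar ?I (emb (\<sigma>' z))" and ?a = "\<lambda>p. abstr (gvars T'') (app_ext (comp \<delta> \<theta>) p)"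
    have "Sub \<theta> \<in> funs \<beta>" if "x \<in> sdom \<theta>" for x
      using that Rec(2) by (auto simp: rec_rhs_def sdom_def)
    then have *: "closed_in (Pat G) (?a p)" if "p \<in> Var ` gvars T' \<union> insert Bot_t (Pat G)" for p
      using closed_in_Pat[of \<delta>, OF renaming_Var[OF Rec(6)] Rec(1), of \<theta> p] that Rec(3) by simp
    have "vran \<theta> \<inter> gvars T'' = {}"
      using G(3) less.prems(1) Rec(1,2) unfolding fresh_ranges_def by blast
    then have inst: "inst C ar ?I (app_ext \<sigma> p) s = inst C ar ?J (?a p) s" if "vars p \<subseteq> gvars T'" for p s
      using inst_comp[OF Rec(6,7), of \<sigma>' \<theta> p] Rec(3,4,15,16) that by simp
    have "\<exists>u. pairing C ar (Pat G) T'' (?a p) (?a q) u \<and> (step ?R)\<^sup>*\<^sup>* u (ocode s t)"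
    proof (rule pairing_complete[where V = "gvars T''" and I = ?J])
      \<comment> \<open>By \<open>inst_app\<close>, instances under \<open>?J\<close> are the
        instances after applying \<sigma>', so the induction hypothesis for \<open>e'\<close>
        applies.\<close>
      show "(step ?R)\<^sup>*\<^sup>* (Var (Gam T'' p q)) (ocode s t)"
        if "indexed (gvars T'') (Pat G) p q" "inst C ar ?J p s" "inst C ar ?J q t" for p q and s t :: "('f, 'v) trm option"
        by (rule less.hyps[OF Rec(13,11,10,12,14) that(1)]) (simp_all add: app_ext_def inst_app that)
      show "ground C ar s" if "?J z s" for z s
        using that oground_inst[OF that] by (cases "\<sigma>' z") auto
    qed (use special inst vars less.prems(6,7) *[OF mem(1)] *[OF mem(2)]
         \<open>s \<noteq> None \<or> t \<noteq> None\<close> compat_comp[OF Rec(5) less.prems(5)] in \<open>auto simp: vars_abstr\<close>)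
    then obtain u where u: "pairing C ar (Pat G) T'' (?a p) (?a q) u"
        "(step ?R)\<^sup>*\<^sup>* u (ocode s t)" by blast
    have "(Gam T' p q, u) \<in> rules ?R" unfolding Ran_def using nt Rec(1,2) u(1) by auto
    then have "step ?R (Var (Gam T' p q)) u" by (rule step.intros)
    with u(2) show ?thesis by (rule converse_rtranclp_into_rtranclp[rotated])
  qed
qed

theorem theorem17:
  fixes C :: "'f set" and ar :: "'f \<Rightarrow> nat"
    and S :: "('f, 'v) subst set" and G :: "('f, 'v) grammar"
    and T :: "('f, 'v) goal" and x1 x2 :: 'v
  assumes "countable (UNIV :: 'v set)" and "infinite (UNIV :: 'v set)"
    and "finite C"
    and "ssg C ar S G"
    and "T \<in> nts G"
    and "x1 \<in> gvars T" and "x2 \<in> gvars T"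
    and "shape_assumption C ar G T"
    and "fresh_ranges G T"
  shows "lang (Ran C ar G T x1 x2) (start (Ran C ar G T x1 x2)) \<supseteq>
    {code (app \<xi> (\<theta> x1)) (app \<xi> (\<theta> x2)) | \<theta> \<xi>.
       \<theta> \<in> Substs S G T \<and> \<xi> \<in> ground_substs C ar \<and> vars (\<theta> x1) \<union> vars (\<theta> x2) = sdom \<xi>}"
proof -
  have "code (app \<xi> (\<theta> x1)) (app \<xi> (\<theta> x2)) \<in> lang (Ran C ar G T x1 x2) (start (Ran C ar G T x1 x2))"
    if \<theta>: "\<theta> \<in> Substs S G T" and \<xi>: "\<xi> \<in> ground_substs C ar" "vars (\<theta> x1) \<union> vars (\<theta> x2) = sdom \<xi>" for \<theta> \<xi>
  proof -
    from \<theta> obtain e where e: "e \<in> lang G T" "sem S e \<theta>" unfolding Substs_def by blast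
    have T: "reachable G T T" by (simp add: reachable_def)
    \<comment> \<open>Every variable of \<open>\<theta> x\<close> lies in \<open>sdom \<xi>\<close>,
      so its image belongs to the range of \<xi> and is ground.\<close>
    have inst: "inst C ar (\<lambda>_. ground C ar) (emb (\<theta> x)) (Some (app \<xi> (\<theta> x)))" if "vars (\<theta> x) \<subseteq> sdom \<xi>" for x
      using \<xi>(1) that Substs_in_terms[OF assms(4,8) T e]
      by (intro inst_emb_ground) (auto simp: ground_substs_def sran_def)
    from inst \<xi>(2) have i: "inst C ar (\<lambda>_. ground C ar) (emb (\<theta> x1)) (Some (app \<xi> (\<theta> x1)))"
        "inst C ar (\<lambda>_. ground C ar) (emb (\<theta> x2)) (Some (app \<xi> (\<theta> x2)))" by blast+
    have "(step (Ran C ar G T x1 x2))\<^sup>*\<^sup>* (Var (Gam T (Var x1) (Var x2)))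
        (ocode (Some (app \<xi> (\<theta> x1))) (Some (app \<xi> (\<theta> x2))))"
      by (rule Ran_complete[OF assms(4,8,9) T assms(5) e])
        (use i assms(6,7) in \<open>auto simp: indexed_def app_ext_def\<close>)
    moreover have "vars (ocode (Some (app \<xi> (\<theta> x1))) (Some (app \<xi> (\<theta> x2)))) = {}"
      using oground_inst[OF i(1)] oground_inst[OF i(2)] by (intro vars_ocode[of _ C ar]) auto
    ultimately show ?thesis by (simp add: lang_def Ran_def)
  qed
  then show ?thesis by blast
qed

end
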